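(* Suppose $Y$ is an intriguing set of the Penttila–Williford association scheme on $X$ with $|Y|=q^2(q-1)$ such that every point of $Y$ is collinear to exactly $q-1$ points of $Y$, and every point of $X\setminus Y$ is collinear to exactly $q^2-q$ points of $Y$. Then there exists a point $p\in H\cap\mathcal Q$ such that $Y$ consists of the $(q^2-q)q$ points of $X=\mathcal Q\setminus H$ that are collinear to $p$.
   Context: Let $q>2$ be a prime power. Let $\mathcal Q$ be an elliptic quadric $\mathsf{Q}^-(5,q)$ in $\mathrm{PG}(5,q)$ with associated polarity $\perp$, $H$ a hyperplane with $H\cap\mathcal Q$ a parabolic quadric $\mathsf Q(4,q)$, $X:=\mathcal Q\setminus H$. Points $u,v\in\mathcal Q$ are collinear ($u\sim v$) if $u\ne v$ and $v\in u^\perp$. For $p\in X$, $p^\sigma$ is the unique point of $\mathcal Q$ other than $p$ on the line joining $H^\perp$ and $p$. The Penttila–Williford scheme has relations on $X$: $R_0=\{(u,v):u=v\}$, $R_1=\{(u,v): v\not\sim u\sim v^\sigma\}$, $R_2=\{(u,v): v\not\sim u\not\sim v^\sigma\}$, $R_3=\{(u,v): v\sim u\not\sim v^\sigma\}$, $R_4=\{(u,v):u=v^\sigma\}$, adjacency matrices $A_0,\dots,A_4$. It is a symmetric association scheme; $\mathbb R^X$ is the orthogonal sum of common eigenspaces $V_0,\dots,V_4$ ($V_0=\langle j\rangle$), numbered so that $A_kv=P_{ik}v$ for $v\in V_i$, with $P=\begin{pmatrix}1&(q-1)(q^2+1)&(q-2)q(q^2+1)&(q-1)(q^2+1)&1\\1&q^2+1&0&-(q^2+1)&-1\\1&q-1&-2q&q-1&1\\1&-(q-1)&0&q-1&-1\\1&-(q-1)^2&2(q-2)q&-(q-1)^2&1\end{pmatrix}$.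 An intriguing set of the scheme is a nonempty proper subset $Y\subseteq X$ whose characteristic vector lies in $V_0\oplus V_i$ for some $i\in\{1,2,3,4\}$. *)

theory Defs
  imports "HOL-Analysis.Cartesian_Space" "HOL-Library.Numeral_Type" "HOL-Library.Indicator_Function"
begin

text \<open>
  \<open>PG(5,q)\<close> is the lattice of subspaces of \<open>'a ^ 6\<close>, where \<open>'a\<close> is a field with \<open>q\<close> elements;
  points and hyperplanes are subspaces of vector space dimension 1 and 5, and incidence is
  inclusion. A quadric is given by a quadratic form. No restriction is placed on the
  characteristic, so everything is phrased with the form itself and not only with its polarization.
\<close>

definition polar :: "('a::field ^ 'n \<Rightarrow> 'a) \<Rightarrow> 'a ^ 'n \<Rightarrow> 'a ^ 'n \<Rightarrow> 'a" where
  "polar f v w = f (v + w) - f v - f w"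

definition quadratic_form :: "('a::field ^ 'n \<Rightarrow> 'a) \<Rightarrow> bool" where
  "quadratic_form f \<longleftrightarrow>
     (\<forall>c v. f (c *s v) = c\<^sup>2 * f v) \<and>
     (\<forall>w. Vector_Spaces.linear (*s) (*) (\<lambda>v. polar f v w))"

definition totally_singular :: "('a::field ^ 'n \<Rightarrow> 'a) \<Rightarrow> ('a ^ 'n) set \<Rightarrow> bool" where
  "totally_singular f S \<longleftrightarrow> (\<forall>v\<in>S. f v = 0)"

text \<open>
  The quadric cut out by \<open>f\<close> on the subspace \<open>W\<close> is nonsingular. In characteristic 2 the
  polarization may still have a radical on \<open>W\<close> (the nucleus), as long as \<open>f\<close> does not vanish there.
\<close>
definition nonsingular_on :: "('a::field ^ 'n \<Rightarrow> 'a) \<Rightarrow> ('a ^ 'n) set \<Rightarrow> bool" where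
  "nonsingular_on f W \<longleftrightarrow> (\<forall>v\<in>W. f v = 0 \<and> (\<forall>w\<in>W. polar f v w = 0) \<longrightarrow> v = 0)"

definition witt_index :: "('a::field ^ 'n \<Rightarrow> 'a) \<Rightarrow> nat" where
  "witt_index f = Max {vec.dim S | S. vec.subspace S \<and> totally_singular f S}"

text \<open>
  \<open>Q\<^sup>-(5,q)\<close> is the nonsingular quadric of \<open>PG(5,q)\<close> of projective index 1, that is, of Witt index 2
  (the hyperbolic quadric \<open>Q\<^sup>+(5,q)\<close> has Witt index 3).
\<close>
definition elliptic_form :: "('a::field ^ 6 \<Rightarrow> 'a) \<Rightarrow> bool" where
  "elliptic_form f \<longleftrightarrow> quadratic_form f \<and> nonsingular_on f UNIV \<and> witt_index f = 2"

definition is_hyperplane :: "('a::field ^ 6) set \<Rightarrow> bool" where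
  "is_hyperplane H \<longleftrightarrow> vec.subspace H \<and> vec.dim H = 5"

text \<open>Every nonsingular quadric of a projective 4-space is a parabolic quadric \<open>Q(4,q)\<close>.\<close>
definition parabolic_section :: "('a::field ^ 6 \<Rightarrow> 'a) \<Rightarrow> ('a ^ 6) set \<Rightarrow> bool" where
  "parabolic_section f H \<longleftrightarrow> is_hyperplane H \<and> nonsingular_on f H"

definition quadric :: "('a::field ^ 6 \<Rightarrow> 'a) \<Rightarrow> ('a ^ 6) set set" where
  "quadric f = {p. vec.subspace p \<and> vec.dim p = 1 \<and> totally_singular f p}"

definition perp :: "('a::field ^ 6 \<Rightarrow> 'a) \<Rightarrow> ('a ^ 6) set \<Rightarrow> ('a ^ 6) set" where
  "perp f S = {w. \<forall>v\<in>S. polar f v w = 0}"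

definition collinear_pts :: "('a::field ^ 6 \<Rightarrow> 'a) \<Rightarrow> ('a ^ 6) set \<Rightarrow> ('a ^ 6) set \<Rightarrow> bool" where
  "collinear_pts f u v \<longleftrightarrow> u \<noteq> v \<and> v \<subseteq> perp f u"

definition pw_points :: "('a::field ^ 6 \<Rightarrow> 'a) \<Rightarrow> ('a ^ 6) set \<Rightarrow> ('a ^ 6) set set" where
  "pw_points f H = {p \<in> quadric f. \<not> p \<subseteq> H}"

text \<open>The span of \<open>perp f H \<union> p\<close> is the projective line joining the points \<open>perp f H\<close> and \<open>p\<close>.\<close>
definition pw_sigma :: "('a::field ^ 6 \<Rightarrow> 'a) \<Rightarrow> ('a ^ 6) set \<Rightarrow> ('a ^ 6) set \<Rightarrow> ('a ^ 6) set" where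
  "pw_sigma f H p = (THE r. r \<in> quadric f \<and> r \<noteq> p \<and> r \<subseteq> vec.span (perp f H \<union> p))"

text \<open>
  Collinearity is irreflexive, so neither \<open>u = v\<close> nor \<open>u = v\<^sup>\<sigma>\<close> is excluded by the two
  non-collinearity conditions of the second relation. They are excluded explicitly: the relations
  of an association scheme are disjoint, and the valency \<open>(q-2)q(q\<^sup>2+1)\<close> requires it.
\<close>
definition pw_rel ::
  "('a::field ^ 6 \<Rightarrow> 'a) \<Rightarrow> ('a ^ 6) set \<Rightarrow> nat \<Rightarrow> ('a ^ 6) set \<Rightarrow> ('a ^ 6) set \<Rightarrow> bool" where
  "pw_rel f H k u v \<longleftrightarrow>
     [u = v,
      \<not> collinear_pts f v u \<and> collinear_pts f u (pw_sigma f H v),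
      u \<noteq> v \<and> u \<noteq> pw_sigma f H v \<and>
        \<not> collinear_pts f v u \<and> \<not> collinear_pts f u (pw_sigma f H v),
      collinear_pts f v u \<and> \<not> collinear_pts f u (pw_sigma f H v),
      u = pw_sigma f H v] ! k"

definition pw_adj ::
  "('a::field ^ 6 \<Rightarrow> 'a) \<Rightarrow> ('a ^ 6) set \<Rightarrow> nat \<Rightarrow> ('a ^ 6) set \<Rightarrow> ('a ^ 6) set \<Rightarrow> real" where
  "pw_adj f H k u v = of_bool (pw_rel f H k u v)"

definition pw_P :: "real \<Rightarrow> nat \<Rightarrow> nat \<Rightarrow> real" where
  "pw_P q i k =
     [[1, (q-1)*(q^2+1), (q-2)*q*(q^2+1), (q-1)*(q^2+1), 1],
      [1, q^2+1, 0, -(q^2+1), -1],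
      [1, q-1, -2*q, q-1, 1],
      [1, -(q-1), 0, q-1, -1],
      [1, -((q-1)^2), 2*(q-2)*q, -((q-1)^2), 1]] ! i ! k"

text \<open>
  The common eigenspaces \<open>V\<^sub>0, \<dots>, V\<^sub>4\<close>; vectors indexed by the point set are functions vanishing
  outside it. The rows of the eigenmatrix are pairwise distinct and so identify the eigenspaces;
  row 0 consists of the valencies and belongs to the all-ones vector.
\<close>
definition pw_eigenspace ::
  "('a::{field,finite} ^ 6 \<Rightarrow> 'a) \<Rightarrow> ('a ^ 6) set \<Rightarrow> nat \<Rightarrow> (('a ^ 6) set \<Rightarrow> real) set" where
  "pw_eigenspace f H i =
     {g. (\<forall>u. u \<notin> pw_points f H \<longrightarrow> g u = 0) \<and>
         (\<forall>k\<le>4. \<forall>u\<in>pw_points f H.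
            (\<Sum>v\<in>pw_points f H. pw_adj f H k u v * g v) = pw_P (real CARD('a)) i k * g u)}"

definition pw_intriguing ::
  "('a::{field,finite} ^ 6 \<Rightarrow> 'a) \<Rightarrow> ('a ^ 6) set \<Rightarrow> ('a ^ 6) set set \<Rightarrow> bool" where
  "pw_intriguing f H Y \<longleftrightarrow>
     Y \<noteq> {} \<and> Y \<subset> pw_points f H \<and>
     (\<exists>i\<in>{1..4}. \<exists>a\<in>pw_eigenspace f H 0. \<exists>b\<in>pw_eigenspace f H i.
        indicator Y = (\<lambda>u. a u + b u))"

end

theory Submission imports Defs begin

text \<open>
  The points and lines of the elliptic quadric form a generalized quadrangle of order \<open>(q, q\<^sup>2)\<close>,
  and the argument is purely combinatorial from there on. Counting pairs shows that all lines on a point \<open>p\<close> of \<open>H\<close>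
  that are not contained in \<open>H\<close> meet \<open>Y\<close> in the same number \<open>m p\<close> of points. The function \<open>g\<close>
  that is the indicator of \<open>Y\<close> on \<open>X\<close> and \<open>1 - m\<close> on \<open>H\<close> is then a weighted ovoid: it sums to \<open>1\<close>
  on every line. Because three pairwise non-collinear points have exactly \<open>q + 1\<close> common
  neighbours, a weighted ovoid satisfies \<open>q (g x + g y) + \<Sum>z\<in>{x,y}\<^sup>\<perp>. g z = q + 1\<close> for non-collinear
  \<open>x\<close>, \<open>y\<close>. Multiplying by \<open>g y\<close> and summing over \<open>y\<close> yields, after inserting \<open>\<Sum>z. (g z)\<^sup>2\<close>,
  \<open>\<Sum>z\<sim>p. g z (g z - 1) = (q - 1) g p (g p + q - 1)\<close>.
  The left-hand side is nonnegative since \<open>g\<close> is integral, so \<open>g p \<ge> 0\<close> or \<open>g p \<le> 1 - q\<close>. The total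
  \<open>\<Sum>z. g z (g z - 1) = q (q - 1)\<close> is positive, hence some \<open>p\<close> in \<open>H\<close> has \<open>g p \<le> 1 - q\<close>, that is,
  \<open>m p = q\<close>, and \<open>Y\<close> is the set of points of \<open>X\<close> collinear with \<open>p\<close>.
\<close>

section \<open>Generalized quadrangles of order (q, q^2)\<close>

text \<open>The pencil size fixes \<open>t = q\<^sup>2\<close>, the largest value possible for a
  quadrangle with \<open>q + 1\<close> points on each line; \<open>card_triad\<close> rests on this
  extremal choice.\<close>

locale gen_quadrangle =
  fixes P :: "'p set" and LL :: "'p set set" and q :: nat
  assumes finite_points: "finite P"
    and order_ge_2: "2 \<le> q"
    and line_subset: "L \<in> LL \<Longrightarrow> L \<subseteq> P"
    and card_line: "L \<in> LL \<Longrightarrow> card L = q + 1"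
    and card_pencil: "p \<in> P \<Longrightarrow> card {L \<in> LL. p \<in> L} = q\<^sup>2 + 1"
    and lines_eq: "L \<in> LL \<Longrightarrow> M \<in> LL \<Longrightarrow> x \<noteq> y \<Longrightarrow> x \<in> L \<Longrightarrow> y \<in> L \<Longrightarrow> x \<in> M \<Longrightarrow> y \<in> M \<Longrightarrow> L = M"
    and projection: "p \<in> P \<Longrightarrow> L \<in> LL \<Longrightarrow> p \<notin> L \<Longrightarrow> \<exists>!x. x \<in> L \<and> (\<exists>M\<in>LL. p \<in> M \<and> x \<in> M)"
begin

section \<open>Collinearity and double counting\<close>

definition col :: "'p \<Rightarrow> 'p \<Rightarrow> bool" where
  "col x y \<longleftrightarrow> x \<noteq> y \<and> (\<exists>L\<in>LL. x \<in> L \<and> y \<in> L)"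

definition nbrs :: "'p \<Rightarrow> 'p set" where
  "nbrs p = {z \<in> P. col p z}"

abbreviation pencil :: "'p \<Rightarrow> 'p set set" where
  "pencil p \<equiv> {L \<in> LL. p \<in> L}"

lemma col_sym: "col x y \<longleftrightarrow> col y x"
  unfolding col_def by blast

lemma not_col_self [simp]: "\<not> col x x"
  unfolding col_def by blast

lemma col_points: "col x y \<Longrightarrow> x \<in> P \<and> y \<in> P"
  unfolding col_def using line_subset by blast

lemma mem_nbrs [simp]: "z \<in> nbrs p \<longleftrightarrow> col p z"
  unfolding nbrs_def using col_points by blast

lemma finite_nbrs [simp]: "finite (nbrs p)"
  unfolding nbrs_def using finite_points by simp

lemma nbrs_subset: "nbrs p \<subseteq> P"
  unfolding nbrs_def by blast

lemma finite_line: "L \<in> LL \<Longrightarrow> finite L"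
  using finite_points line_subset finite_subset by blast

lemma finite_lines: "finite LL"
  using finite_points line_subset by (meson PowI finite_Pow_iff finite_subset subsetI)

lemma unique_projection:
  assumes "L \<in> LL" "y \<in> P" "y \<notin> L" "x \<in> L" "x' \<in> L" "col x y" "col x' y"
  shows "x = x'"
  using projection[OF assms(2,1,3)] assms unfolding col_def by blast

text \<open>If \<open>z\<close> were off \<open>L\<close>, both \<open>x\<close> and
  \<open>y\<close> would be its projection onto \<open>L\<close>.\<close>

lemma no_triangle:
  assumes "L \<in> LL" "x \<in> L" "y \<in> L" "x \<noteq> y" "col x z" "col y z"
  shows "z \<in> L"
  using unique_projection[OF assms(1) _ _ assms(2,3,5,6)] assms(4,5) col_points by blast

lemma card_projection:
  assumes "L \<in> LL" "y \<in> P"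
  shows "card {x \<in> L. col x y} = (if y \<in> L then q else 1)"
proof (cases "y \<in> L")
  case True
  then have "{x \<in> L. col x y} = L - {y}"
    using assms unfolding col_def by auto
  with True show ?thesis
    using card_line[OF assms(1)] finite_line[OF assms(1)] by simp
next
  case False
  then obtain x where x: "x \<in> L" "\<exists>M\<in>LL. y \<in> M \<and> x \<in> M"
    using projection[OF assms(2,1)] by blast
  then have "col x y" using False unfolding col_def by blast
  with x have "{x \<in> L. col x y} = {x}"
    using unique_projection[OF assms(1,2) False] by blast
  with False show ?thesis by simp
qed

lemma nbrs_eq_Union: "nbrs p = (\<Union>L\<in>pencil p. L - {p})"
  using line_subset unfolding nbrs_def col_def by blast

text \<open>By \<open>lines_eq\<close> the lines on \<open>p\<close>, with \<open>p\<close> removed,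
  partition the neighbours of \<open>p\<close>, so local sums can be taken line by line.\<close>

lemma sum_nbrs:
  fixes h :: "'p \<Rightarrow> int"
  shows "sum h (nbrs p) = (\<Sum>L\<in>pencil p. sum h (L - {p}))"
  unfolding nbrs_eq_Union
proof (rule sum.UNION_disjoint)
  show "finite (pencil p)" using finite_lines by simp
  show "\<forall>L\<in>pencil p. finite (L - {p})" using finite_line by blast
  show "\<forall>L\<in>pencil p. \<forall>M\<in>pencil p. L \<noteq> M \<longrightarrow> (L - {p}) \<inter> (M - {p}) = {}"
    using lines_eq by blast
qed

lemma card_nbrs: "p \<in> P \<Longrightarrow> int (card (nbrs p)) = int q * ((int q)\<^sup>2 + 1)"
  using sum_nbrs[of "\<lambda>_. 1" p] card_line finite_line
  by (simp add: card_pencil algebra_simps)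

lemma int_card_eq_sum: "finite A \<Longrightarrow> int (card (A \<inter> B)) = (\<Sum>z\<in>A. of_bool (z \<in> B))"
  using sum.inter_restrict[of A "\<lambda>_. 1 :: int" B] by (simp add: of_bool_def)

lemma sum_of_bool_times:
  fixes h :: "'p \<Rightarrow> int"
  assumes "A \<subseteq> P"
  shows "(\<Sum>z\<in>P. of_bool (z \<in> A) * h z) = sum h A"
  using assms finite_points by (intro sum.mono_neutral_cong_right) auto

text \<open>Each of the \<open>q\<^sup>2 + 1\<close> lines on \<open>x\<close> misses
  \<open>y\<close>, hence carries exactly one neighbour of \<open>y\<close>, and that neighbour is
  not \<open>x\<close>.\<close>

lemma card_common:
  assumes "x \<in> P" "y \<in> P" "x \<noteq> y" "\<not> col x y"
  shows "int (card (nbrs x \<inter> nbrs y)) = (int q)\<^sup>2 + 1"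
proof -
  have "(\<Sum>z\<in>L - {x}. of_bool (z \<in> nbrs y)) = (1 :: int)" if L: "L \<in> pencil x" for L
  proof -
    have y: "y \<notin> L" using L assms unfolding col_def by blast
    have "(L - {x}) \<inter> nbrs y = {z \<in> L. col z y}"
      using assms col_sym by auto
    then have "card ((L - {x}) \<inter> nbrs y) = 1"
      using card_projection[of L y] L y assms by simp
    then show ?thesis
      using int_card_eq_sum[of "L - {x}" "nbrs y"] finite_line L by auto
  qed
  then show ?thesis
    unfolding int_card_eq_sum[OF finite_nbrs] sum_nbrs
    by (simp add: card_pencil[OF assms(1)])
qed

text \<open>Double counting of collinear pairs \<open>(z, e)\<close> with \<open>e \<in> E\<close>,
  weighted by \<open>h z\<close>. It is applied to lines, to sets of common neighbours and to
  \<open>Y\<close>.\<close>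

lemma sum_times_card:
  fixes h :: "'p \<Rightarrow> int"
  assumes "E \<subseteq> P"
  shows "(\<Sum>z\<in>P. h z * int (card (nbrs z \<inter> E))) = (\<Sum>e\<in>E. sum h (nbrs e))"
proof -
  have fE: "finite E" using assms finite_points finite_subset by blast
  have "int (card (nbrs z \<inter> E)) = (\<Sum>e\<in>E. of_bool (col z e))" for z
    by (subst Int_commute) (simp only: int_card_eq_sum[OF fE] mem_nbrs)
  then have "(\<Sum>z\<in>P. h z * int (card (nbrs z \<inter> E))) = (\<Sum>z\<in>P. \<Sum>e\<in>E. h z * of_bool (col z e))"
    by (simp only: sum_distrib_left)
  also have "\<dots> = (\<Sum>e\<in>E. \<Sum>z\<in>P. h z * of_bool (col z e))"
    by (rule sum.swap)
  also have "\<dots> = (\<Sum>e\<in>E. sum h (nbrs e))"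
  proof (rule sum.cong[OF refl])
    fix e
    have "nbrs e = P \<inter> {z. col z e}" unfolding nbrs_def using col_sym by blast
    then show "(\<Sum>z\<in>P. h z * of_bool (col z e)) = sum h (nbrs e)"
      using finite_points by (intro sum.mono_neutral_cong_right) auto
  qed
  finally show ?thesis .
qed

text \<open>In the double count over \<open>L\<close>, a point off \<open>L\<close> has one
  neighbour on \<open>L\<close> and a point on \<open>L\<close> has \<open>q\<close>; the excess is
  \<open>q - 1\<close> on the points of \<open>L\<close>.\<close>

lemma sum_points:
  fixes h :: "'p \<Rightarrow> int"
  assumes "L \<in> LL"
  shows "sum h P = (\<Sum>x\<in>L. sum h (nbrs x)) - (int q - 1) * sum h L"
proof -
  have L: "L \<subseteq> P" using assms line_subset by blast
  have "(\<Sum>x\<in>L. sum h (nbrs x)) = (\<Sum>z\<in>P. h z * int (card (nbrs z \<inter> L)))"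
    using sum_times_card[OF L] by simp
  also have "\<dots> = (\<Sum>z\<in>P. h z + (int q - 1) * (of_bool (z \<in> L) * h z))"
  proof (rule sum.cong[OF refl])
    fix z assume z: "z \<in> P"
    have "nbrs z \<inter> L = {x \<in> L. col x z}" using col_sym by auto
    then show "h z * int (card (nbrs z \<inter> L)) = h z + (int q - 1) * (of_bool (z \<in> L) * h z)"
      using card_projection[OF assms z] by (simp add: algebra_simps)
  qed
  also have "\<dots> = sum h P + (int q - 1) * sum h L"
    using sum_of_bool_times[OF L, of h] by (simp add: sum.distrib flip: sum_distrib_left)
  finally show ?thesis by simp
qed

lemma ex_line: "p \<in> P \<Longrightarrow> \<exists>L\<in>LL. p \<in> L"
  using card_pencil[of p] by (metis (mono_tags, lifting) Collect_empty_eq add_is_0 card.empty one_neq_zero)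

lemma card_points:
  assumes "p \<in> P"
  shows "int (card P) = (int q + 1) * (int q ^ 3 + 1)"
proof -
  obtain L where L: "L \<in> LL" using ex_line assms by blast
  have "(\<Sum>x\<in>L. int (card (nbrs x))) = (\<Sum>x\<in>L. int q * ((int q)\<^sup>2 + 1))"
    using card_nbrs line_subset[OF L] by (intro sum.cong) auto
  then show ?thesis
    using sum_points[OF L, of "\<lambda>_. 1"] card_line[OF L]
    by (simp add: algebra_simps power2_eq_square power3_eq_cube)
qed

section \<open>Common neighbours of two non-collinear points, and triads\<close>

context
  fixes x y
  assumes xy: "x \<in> P" "y \<in> P" "x \<noteq> y" "\<not> col x y"
begin

text \<open>By \<open>no_triangle\<close> the common neighbours of \<open>x\<close> and
  \<open>z\<close> lie on the line joining them, and \<open>y\<close> has a single projection onto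
  that line.\<close>

lemma card_common_x_only:
  assumes "col x z" "\<not> col y z" "z \<noteq> y"
  shows "card (nbrs z \<inter> (nbrs x \<inter> nbrs y)) = 1"
proof -
  from assms(1) obtain L where L: "L \<in> LL" "x \<in> L" "z \<in> L" "x \<noteq> z" unfolding col_def by blast
  have "y \<notin> L" using L xy unfolding col_def by blast
  have "nbrs z \<inter> (nbrs x \<inter> nbrs y) = {e \<in> L. col e y}"
  proof (intro equalityI subsetI)
    fix e assume "e \<in> nbrs z \<inter> (nbrs x \<inter> nbrs y)"
    then show "e \<in> {e \<in> L. col e y}"
      using no_triangle[OF L(1,2,3,4)] col_sym by auto
  next
    fix e assume e: "e \<in> {e \<in> L. col e y}"
    then have "e \<noteq> x" "e \<noteq> z" using xy assms col_sym by blast+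
    then have "col z e" "col x e" using L e unfolding col_def by blast+
    with e show "e \<in> nbrs z \<inter> (nbrs x \<inter> nbrs y)" using col_sym by auto
  qed
  then show ?thesis using card_projection[OF L(1) xy(2)] \<open>y \<notin> L\<close> by simp
qed

text \<open>By \<open>no_triangle\<close>, two collinear common neighbours would share a line with
  \<open>x\<close>, and \<open>y\<close> would have two projections onto it.\<close>

lemma common_not_col:
  assumes "z \<in> nbrs x \<inter> nbrs y" "e \<in> nbrs x \<inter> nbrs y"
  shows "\<not> col z e"
proof
  assume "col z e"
  have "col x z" using assms by simp
  then obtain L where L: "L \<in> LL" "x \<in> L" "z \<in> L" "x \<noteq> z" unfolding col_def by blast
  have "y \<notin> L" using L xy unfolding col_def by blast
  have "e \<in> L" using no_triangle[OF L] assms \<open>col z e\<close> by auto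
  then have "z = e" using unique_projection[OF L(1) xy(2) \<open>y \<notin> L\<close>, of z e] L assms col_sym by auto
  then show False using \<open>col z e\<close> by simp
qed

end

text \<open>
  The number of centers of a triad over a fixed pair of points has variance zero, because the
  quadrangle has order \<open>(q, q\<^sup>2)\<close>.
\<close>
lemma card_triad:
  assumes xy: "x \<in> P" "y \<in> P" "x \<noteq> y" "\<not> col x y"
    and z: "z \<in> P" "z \<noteq> x" "z \<noteq> y" "\<not> col x z" "\<not> col y z"
  shows "card (nbrs z \<inter> (nbrs x \<inter> nbrs y)) = q + 1"
proof -
  define E where "E = nbrs x \<inter> nbrs y"
  define c where "c z = int (card (nbrs z \<inter> E))" for z
  define N1 where "N1 = nbrs x - E"
  define N2 where "N2 = nbrs y - E"
  \<comment> \<open>\<open>T\<close> collects the points that complete \<open>x\<close>,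
    \<open>y\<close> to a triad. On the four other classes the value of \<open>c\<close> is already
    known.\<close>
  define T where "T = P - ({x, y} \<union> (E \<union> (N1 \<union> N2)))"
  define Q where "Q = int q"
  have yx: "\<not> col y x" using xy col_sym by blast
  have fin: "finite E" "finite N1" "finite N2" "finite T"
    unfolding E_def N1_def N2_def T_def using finite_points by auto
  have EP: "E \<subseteq> P" unfolding E_def using nbrs_subset by blast
  have cE: "int (card E) = Q\<^sup>2 + 1"
    unfolding E_def Q_def by (rule card_common[OF xy])
  have "int (card N1) = int (card (nbrs x)) - int (card E)"
    unfolding N1_def E_def
    by (metis Int_lower1 card_Diff_subset card_mono finite_Int finite_nbrs of_nat_diff)
  then have cN1: "int (card N1) = (Q - 1) * (Q\<^sup>2 + 1)"
    using card_nbrs[OF xy(1)] cE by (simp add: Q_def algebra_simps)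
  have "int (card N2) = int (card (nbrs y)) - int (card E)"
    unfolding N2_def E_def
    by (metis Int_lower2 card_Diff_subset card_mono finite_Int finite_nbrs of_nat_diff)
  then have cN2: "int (card N2) = (Q - 1) * (Q\<^sup>2 + 1)"
    using card_nbrs[OF xy(2)] cE by (simp add: Q_def algebra_simps)
  have c_x: "c x = Q\<^sup>2 + 1" and c_y: "c y = Q\<^sup>2 + 1"
    using cE unfolding c_def E_def by (simp_all add: Int_absorb1)
  have c_E: "c z = 0" if "z \<in> E" for z
  proof -
    have "nbrs z \<inter> E = {}" using common_not_col[OF xy that[unfolded E_def]] unfolding E_def by auto
    then show ?thesis unfolding c_def by simp
  qed
  have c_N1: "c z = 1" if "z \<in> N1" for z
  proof -
    have "card (nbrs z \<inter> (nbrs x \<inter> nbrs y)) = 1"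
      using card_common_x_only[OF xy, of z] that xy unfolding N1_def E_def by auto
    then show ?thesis unfolding c_def E_def by simp
  qed
  have c_N2: "c z = 1" if "z \<in> N2" for z
  proof -
    have "card (nbrs z \<inter> (nbrs y \<inter> nbrs x)) = 1"
      using card_common_x_only[of y x z] that xy yx unfolding N2_def E_def by auto
    then show ?thesis unfolding c_def E_def by (simp add: Int_commute)
  qed
  have split: "sum h P = h x + h y + sum h E + sum h N1 + sum h N2 + sum h T" for h :: "'p \<Rightarrow> int"
  proof -
    have "sum h P = sum h ({x, y} \<union> (E \<union> (N1 \<union> N2))) + sum h T"
      unfolding T_def using finite_points fin(1-3) xy nbrs_subset EP
      by (subst add.commute, intro sum.subset_diff) (auto simp: N1_def N2_def E_def nbrs_def)
    also have "sum h ({x, y} \<union> (E \<union> (N1 \<union> N2))) = sum h {x, y} + sum h (E \<union> (N1 \<union> N2))"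
      by (rule sum.union_disjoint) (use fin xy yx in \<open>auto simp: E_def N1_def N2_def\<close>)
    also have "sum h (E \<union> (N1 \<union> N2)) = sum h E + sum h (N1 \<union> N2)"
      by (rule sum.union_disjoint) (use fin in \<open>auto simp: E_def N1_def N2_def\<close>)
    also have "sum h (N1 \<union> N2) = sum h N1 + sum h N2"
      by (rule sum.union_disjoint) (use fin in \<open>auto simp: E_def N1_def N2_def\<close>)
    finally show ?thesis using xy by simp
  qed
  have nb: "int (card (nbrs e)) = Q * (Q\<^sup>2 + 1)" if "e \<in> E" for e
    using card_nbrs EP that Q_def by blast
  have "(\<Sum>z\<in>P. c z) = (\<Sum>e\<in>E. int (card (nbrs e)))"
    using sum_times_card[OF EP, of "\<lambda>_. 1"] by (simp add: c_def)
  also have "\<dots> = Q * (Q\<^sup>2 + 1)\<^sup>2"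
    using nb cE by (simp add: power2_eq_square)
  finally have sum_c: "(\<Sum>z\<in>P. c z) = Q * (Q\<^sup>2 + 1)\<^sup>2" .
  \<comment> \<open>The second moment counts \<open>z\<close> with ordered pairs of its neighbours
    in \<open>E\<close>. A pair of equal points contributes all its neighbours; two distinct points
    of \<open>E\<close> are not collinear and contribute \<open>Q\<^sup>2 + 1\<close>.\<close>
  have "(\<Sum>z\<in>P. c z * c z) = (\<Sum>e\<in>E. \<Sum>z\<in>nbrs e. c z)"
    using sum_times_card[OF EP, of c] by (simp add: c_def)
  also have "\<dots> = (\<Sum>e\<in>E. Q * (Q\<^sup>2 + 1) + Q\<^sup>2 * (Q\<^sup>2 + 1))"
  proof (rule sum.cong[OF refl])
    fix e assume e: "e \<in> E"
    have "(\<Sum>z\<in>nbrs e. c z) = (\<Sum>z\<in>P. of_bool (z \<in> nbrs e) * c z)"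
      using sum_of_bool_times[OF nbrs_subset] by simp
    also have "\<dots> = (\<Sum>e'\<in>E. int (card (nbrs e' \<inter> nbrs e)))"
      using sum_times_card[OF EP, of "\<lambda>z. of_bool (z \<in> nbrs e)"]
      by (simp only: c_def int_card_eq_sum[OF finite_nbrs])
    also have "\<dots> = int (card (nbrs e \<inter> nbrs e)) + (\<Sum>e'\<in>E - {e}. int (card (nbrs e' \<inter> nbrs e)))"
      using e fin by (simp add: sum.remove)
    also have "(\<Sum>e'\<in>E - {e}. int (card (nbrs e' \<inter> nbrs e))) = (\<Sum>e'\<in>E - {e}. Q\<^sup>2 + 1)"
    proof (rule sum.cong[OF refl])
      fix e' assume e': "e' \<in> E - {e}"
      have "\<not> col e' e"
        using common_not_col[OF xy, of e' e] e e' unfolding E_def by blast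
      then show "int (card (nbrs e' \<inter> nbrs e)) = Q\<^sup>2 + 1"
        unfolding Q_def using e e' EP by (intro card_common) auto
    qed
    also have "\<dots> = Q\<^sup>2 * (Q\<^sup>2 + 1)"
    proof -
      have "int (card (E - {e})) = Q\<^sup>2"
        using card_Suc_Diff1[OF fin(1) e] cE by linarith
      then show ?thesis by simp
    qed
    finally show "(\<Sum>z\<in>nbrs e. c z) = Q * (Q\<^sup>2 + 1) + Q\<^sup>2 * (Q\<^sup>2 + 1)"
      using nb[OF e] by simp
  qed
  also have "\<dots> = (Q\<^sup>2 + 1) * (Q * (Q\<^sup>2 + 1) + Q\<^sup>2 * (Q\<^sup>2 + 1))"
    using cE by simp
  finally have sum_cc: "(\<Sum>z\<in>P. c z * c z) = (Q\<^sup>2 + 1) * (Q * (Q\<^sup>2 + 1) + Q\<^sup>2 * (Q\<^sup>2 + 1))" .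
  have T1: "(\<Sum>z\<in>T. c z) = (Q\<^sup>2 + 1) * Q * (Q\<^sup>2 - 1)"
    using split[of c] cN1 cN2 unfolding sum_c
    by (simp add: c_x c_y c_E c_N1 c_N2) algebra
  have T2: "(\<Sum>z\<in>T. c z * c z) = (Q\<^sup>2 + 1) * (Q\<^sup>2 - 1) * (Q\<^sup>2 + Q)"
    using split[of "\<lambda>z. c z * c z"] cN1 cN2 unfolding sum_cc
    by (simp add: c_x c_y c_E c_N1 c_N2) algebra
  have T0: "int (card T) = Q * (Q - 1) * (Q\<^sup>2 + 1)"
    using split[of "\<lambda>_. 1"] cN1 cN2 cE card_points[OF xy(1), folded Q_def]
    by simp algebra
  \<comment> \<open>\<open>Q + 1\<close> is the mean of \<open>c\<close> on \<open>T\<close>, the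
    quotient of the values in \<open>T1\<close> and \<open>T0\<close>.\<close>
  have "(\<Sum>z\<in>T. (c z - (Q + 1))\<^sup>2) = (\<Sum>z\<in>T. c z * c z - 2 * (Q + 1) * c z + (Q + 1)\<^sup>2)"
    by (intro sum.cong refl) algebra
  also have "\<dots> = (\<Sum>z\<in>T. c z * c z) - 2 * (Q + 1) * (\<Sum>z\<in>T. c z) + int (card T) * (Q + 1)\<^sup>2"
    by (simp add: sum.distrib sum_subtractf flip: sum_distrib_left)
  also have "\<dots> = 0"
    unfolding T0 T1 T2 by algebra
  finally have "(\<Sum>z\<in>T. (c z - (Q + 1))\<^sup>2) = 0" .
  then have "\<forall>z\<in>T. (c z - (Q + 1))\<^sup>2 = 0"
    using fin by (subst (asm) sum_nonneg_eq_0_iff) auto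
  moreover have "z \<in> T"
    using z unfolding T_def N1_def N2_def E_def by auto
  ultimately have "c z = Q + 1" by simp
  then show ?thesis unfolding c_def E_def Q_def by linarith
qed


section \<open>Weighted ovoids: integer weights with sum 1 on every line\<close>

context
  fixes g :: "'p \<Rightarrow> int"
  assumes sum_line: "L \<in> LL \<Longrightarrow> sum g L = 1"
begin

lemma sum_line_diff:
  assumes "L \<in> LL" "p \<in> L"
  shows "sum g (L - {p}) = 1 - g p"
  using sum_line[OF assms(1)] assms finite_line by (simp add: sum_diff1)

lemma ovoid_nbrs:
  assumes "p \<in> P"
  shows "sum g (nbrs p) = ((int q)\<^sup>2 + 1) * (1 - g p)"
  using sum_nbrs[of g p] card_pencil[OF assms] by (simp add: sum_line_diff)

text \<open>\<open>q ^ 3 + 1\<close> is the size of a genuine ovoid; any single line yields it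
  through \<open>sum_points\<close>.\<close>

lemma ovoid_total:
  assumes "p \<in> P"
  shows "sum g P = int q ^ 3 + 1"
proof -
  obtain L where L: "L \<in> LL" using ex_line assms by blast
  have "(\<Sum>x\<in>L. sum g (nbrs x)) = (\<Sum>x\<in>L. ((int q)\<^sup>2 + 1) * (1 - g x))"
    using ovoid_nbrs line_subset[OF L] by (intro sum.cong) auto
  also have "\<dots> = ((int q)\<^sup>2 + 1) * (int q + 1 - 1)"
    using card_line[OF L] sum_line[OF L] by (simp add: sum_subtractf flip: sum_distrib_left)
  finally show ?thesis
    using sum_points[OF L, of g] sum_line[OF L]
    by (simp add: algebra_simps power2_eq_square power3_eq_cube)
qed

text \<open>By \<open>card_triad\<close> the number of neighbours of \<open>z\<close> in
  \<open>E\<close> depends only on the position of \<open>z\<close> relative to \<open>x\<close> and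
  \<open>y\<close>. The weighted count of collinear pairs between \<open>P\<close> and
  \<open>E\<close> is therefore computable from either side, and comparing the results isolates
  \<open>sum g E\<close>.\<close>

lemma ovoid_common:
  assumes xy: "x \<in> P" "y \<in> P" "x \<noteq> y" "\<not> col x y"
  shows "int q * (g x + g y) + sum g (nbrs x \<inter> nbrs y) = int q + 1"
proof -
  define E where "E = nbrs x \<inter> nbrs y"
  define Q where "Q = int q"
  have Q: "Q \<ge> 2" using order_ge_2 unfolding Q_def by simp
  have yx: "\<not> col y x" using xy col_sym by blast
  have EP: "E \<subseteq> P" unfolding E_def using nbrs_subset by blast
  have cE: "int (card E) = Q\<^sup>2 + 1" unfolding E_def Q_def by (rule card_common[OF xy])
  \<comment> \<open>One formula for all positions: \<open>Q\<^sup>2 + 1\<close> at \<open>x\<close>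
    and \<open>y\<close>, \<open>0\<close> on \<open>E\<close>, \<open>1\<close> at points collinear
    with exactly one of \<open>x\<close>, \<open>y\<close>, and \<open>Q + 1\<close> at
    triads.\<close>
  have c: "int (card (nbrs z \<inter> E)) = (Q + 1) - Q * of_bool (z \<in> nbrs x) - Q * of_bool (z \<in> nbrs y)
      + (Q - 1) * of_bool (z \<in> E) + (Q\<^sup>2 - Q) * of_bool (z \<in> {x, y})" if "z \<in> P" for z
  proof -
    consider "z = x \<or> z = y" | "z \<in> E" | "col x z" "\<not> col y z" "z \<noteq> y" | "\<not> col x z" "col y z" "z \<noteq> x"
      | "z \<noteq> x" "z \<noteq> y" "\<not> col x z" "\<not> col y z"
      using xy yx unfolding E_def by auto
    then show ?thesis
    proof cases
      case 1
      then have "nbrs z \<inter> E = E" "z \<notin> E" "z \<in> {x, y}" unfolding E_def by auto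
      moreover have "\<not> col x z" "\<not> col y z" using 1 xy yx by auto
      ultimately show ?thesis using cE by simp
    next
      case 2
      then have "nbrs z \<inter> E = {}" using common_not_col[OF xy 2[unfolded E_def]] unfolding E_def by auto
      moreover have "z \<noteq> x" "z \<noteq> y" "col x z" "col y z" using 2 xy unfolding E_def by auto
      ultimately show ?thesis using 2 by simp
    next
      case 3
      then have "card (nbrs z \<inter> E) = 1"
        unfolding E_def by (intro card_common_x_only[OF xy])
      moreover have "z \<noteq> x" "z \<notin> E" using 3 unfolding E_def by auto
      ultimately show ?thesis using 3 by simp
    next
      case 4
      then have "card (nbrs z \<inter> (nbrs y \<inter> nbrs x)) = 1"
        using xy yx by (intro card_common_x_only) auto
      moreover have "z \<noteq> y" "z \<notin> E" using 4 unfolding E_def by auto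
      ultimately show ?thesis using 4 by (simp add: E_def Int_commute)
    next
      case 5
      then have "card (nbrs z \<inter> E) = q + 1"
        unfolding E_def using that by (intro card_triad[OF xy])
      with 5 show ?thesis by (simp add: E_def Q_def)
    qed
  qed
  have "(\<Sum>e\<in>E. sum g (nbrs e)) = (\<Sum>z\<in>P. g z * int (card (nbrs z \<inter> E)))"
    using sum_times_card[OF EP] by simp
  also have "\<dots> = (\<Sum>z\<in>P. (Q + 1) * g z - Q * (of_bool (z \<in> nbrs x) * g z) - Q * (of_bool (z \<in> nbrs y) * g z)
      + (Q - 1) * (of_bool (z \<in> E) * g z) + (Q\<^sup>2 - Q) * (of_bool (z \<in> {x, y}) * g z))"
    by (intro sum.cong refl) (simp only: c, algebra)
  also have "\<dots> = (Q + 1) * sum g P - Q * sum g (nbrs x) - Q * sum g (nbrs y)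
      + (Q - 1) * sum g E + (Q\<^sup>2 - Q) * sum g {x, y}"
    using xy EP by (simp only: sum.distrib sum_subtractf sum_distrib_left[symmetric] sum_of_bool_times
        nbrs_subset insert_subset empty_subsetI simp_thms)
  also have "sum g {x, y} = g x + g y" using xy by simp
  finally have 1: "(\<Sum>e\<in>E. sum g (nbrs e)) = (Q + 1) * (Q ^ 3 + 1) - Q * ((Q\<^sup>2 + 1) * (1 - g x))
      - Q * ((Q\<^sup>2 + 1) * (1 - g y)) + (Q - 1) * sum g E + (Q\<^sup>2 - Q) * (g x + g y)"
    unfolding Q_def ovoid_total[OF xy(1)] ovoid_nbrs[OF xy(1)] ovoid_nbrs[OF xy(2)] .
  \<comment> \<open>The same sum, now evaluated from the side of \<open>E\<close>.\<close>
  have "(\<Sum>e\<in>E. sum g (nbrs e)) = (\<Sum>e\<in>E. (Q\<^sup>2 + 1) * (1 - g e))"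
    using ovoid_nbrs EP unfolding Q_def by (intro sum.cong) auto
  also have "\<dots> = (Q\<^sup>2 + 1) * (Q\<^sup>2 + 1 - sum g E)"
    using cE by (simp add: sum_subtractf flip: sum_distrib_left)
  finally have "Q * (Q + 1) * (Q * (g x + g y) + sum g E) = Q * (Q + 1) * (Q + 1)"
    using 1 by algebra
  then have "Q * (g x + g y) + sum g E = Q + 1"
    using Q by simp
  then show ?thesis unfolding Q_def E_def .
qed

text \<open>\<open>ovoid_common\<close> for the pair \<open>p\<close>, \<open>r\<close> is
  multiplied by \<open>g r\<close> and summed over all \<open>r\<close> not collinear with
  \<open>p\<close>; interchanging the summation gives a second value of the mixed term. The total of
  the squares stays a parameter here.\<close>

lemma ovoid_second_moment:
  assumes p: "p \<in> P"
  shows "(int q + 1) * (\<Sum>z\<in>nbrs p. g z * (g z - 1)) =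
    ((int q)\<^sup>2 - 1) * (g p)\<^sup>2 + (int q - 1) * ((int q)\<^sup>2 - 1) * g p
      + (\<Sum>z\<in>P. (g z)\<^sup>2) - int q ^ 3 - (int q)\<^sup>2 + int q - 1"
proof -
  define W where "W = P - insert p (nbrs p)"
  define Q where "Q = int q"
  have Q: "Q \<ge> 2" using order_ge_2 unfolding Q_def by simp
  have OP: "W \<subseteq> P" unfolding W_def by blast
  have split: "sum h P = h p + sum h (nbrs p) + sum h W" for h :: "'p \<Rightarrow> int"
  proof -
    have "sum h P = sum h (insert p (nbrs p)) + sum h W"
      unfolding W_def using p finite_points nbrs_subset by (subst add.commute, intro sum.subset_diff) auto
    then show ?thesis by simp
  qed
  have S1: "sum g (nbrs p) = (Q\<^sup>2 + 1) * (1 - g p)"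
    unfolding Q_def by (rule ovoid_nbrs[OF p])
  have SO: "sum g W = Q\<^sup>2 * (Q - 1 + g p)"
    using split[of g] S1 ovoid_total[OF p, folded Q_def] by algebra
  \<comment> \<open>Only the line \<open>M\<close> joining \<open>r\<close> to \<open>p\<close>
    avoids \<open>W\<close>. Each of the other \<open>q\<^sup>2\<close> lines on \<open>r\<close>
    lies in \<open>W\<close> apart from \<open>r\<close> itself, because \<open>r\<close> is the
    projection of \<open>p\<close> onto it.\<close>
  have inner: "(\<Sum>z\<in>nbrs r. of_bool (z \<in> W) * g z) = Q\<^sup>2 * (1 - g r)" if r: "col p r" for r
  proof -
    obtain M where M: "M \<in> LL" "p \<in> M" "r \<in> M" "p \<noteq> r" using r unfolding col_def by blast
    have rP: "r \<in> P" using r col_points by blast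
    have MM: "M \<in> pencil r" using M by simp
    have fp: "finite (pencil r)" using finite_lines by simp
    have "(\<Sum>z\<in>nbrs r. of_bool (z \<in> W) * g z) = (\<Sum>L\<in>pencil r. \<Sum>z\<in>L - {r}. of_bool (z \<in> W) * g z)"
      by (rule sum_nbrs)
    also have "\<dots> = (\<Sum>z\<in>M - {r}. of_bool (z \<in> W) * g z)
        + (\<Sum>L\<in>pencil r - {M}. \<Sum>z\<in>L - {r}. of_bool (z \<in> W) * g z)"
      by (rule sum.remove[OF fp MM])
    also have "(\<Sum>z\<in>M - {r}. of_bool (z \<in> W) * g z) = 0"
      using M unfolding W_def nbrs_def col_def by (intro sum.neutral) auto
    also have "(\<Sum>L\<in>pencil r - {M}. \<Sum>z\<in>L - {r}. of_bool (z \<in> W) * g z) = (\<Sum>L\<in>pencil r - {M}. 1 - g r)"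
    proof (rule sum.cong[OF refl])
      fix L assume L: "L \<in> pencil r - {M}"
      have "z \<in> W" if z: "z \<in> L - {r}" for z
      proof -
        have "p \<notin> L" using L M lines_eq[of L M p r] by blast
        have "z \<noteq> p" using \<open>p \<notin> L\<close> z by blast
        moreover have "\<not> col p z"
          using unique_projection[of L p z r] L z \<open>p \<notin> L\<close> p r col_sym by auto
        ultimately show ?thesis using z L line_subset unfolding W_def by auto
      qed
      then have "(\<Sum>z\<in>L - {r}. of_bool (z \<in> W) * g z) = sum g (L - {r})"
        by (intro sum.cong) auto
      then show "(\<Sum>z\<in>L - {r}. of_bool (z \<in> W) * g z) = 1 - g r"
        using sum_line_diff L by simp
    qed
    also have "\<dots> = Q\<^sup>2 * (1 - g r)"
    proof -
      have "card (pencil r - {M}) = q\<^sup>2"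
        using card_Suc_Diff1[OF fp MM] card_pencil[OF rP] by linarith
      then show ?thesis by (simp add: Q_def)
    qed
    finally show ?thesis by simp
  qed
  have "(\<Sum>r\<in>W. g r * sum g (nbrs p \<inter> nbrs r)) = (\<Sum>r\<in>W. \<Sum>z\<in>nbrs p. g r * (of_bool (col z r) * g z))"
  proof (rule sum.cong[OF refl])
    fix r
    have "sum g (nbrs p \<inter> nbrs r) = (\<Sum>z\<in>nbrs p. of_bool (col z r) * g z)"
      using col_sym by (intro sum.mono_neutral_cong_left) auto
    then show "g r * sum g (nbrs p \<inter> nbrs r) = (\<Sum>z\<in>nbrs p. g r * (of_bool (col z r) * g z))"
      by (simp only: sum_distrib_left)
  qed
  also have "\<dots> = (\<Sum>z\<in>nbrs p. \<Sum>r\<in>W. g r * (of_bool (col z r) * g z))"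
    by (rule sum.swap)
  also have "\<dots> = (\<Sum>z\<in>nbrs p. g z * (\<Sum>r\<in>nbrs z. of_bool (r \<in> W) * g r))"
  proof (rule sum.cong[OF refl])
    fix z
    have "(\<Sum>r\<in>W. g r * (of_bool (col z r) * g z)) = (\<Sum>r\<in>P. g z * (of_bool (r \<in> W) * of_bool (col z r) * g r))"
      using OP finite_points by (intro sum.mono_neutral_cong_left) auto
    also have "\<dots> = (\<Sum>r\<in>nbrs z. g z * (of_bool (r \<in> W) * g r))"
      using nbrs_subset finite_points by (intro sum.mono_neutral_cong_right) auto
    finally show "(\<Sum>r\<in>W. g r * (of_bool (col z r) * g z)) = g z * (\<Sum>r\<in>nbrs z. of_bool (r \<in> W) * g r)"
      by (simp only: sum_distrib_left)
  qed
  also have "\<dots> = (\<Sum>z\<in>nbrs p. Q\<^sup>2 * g z - Q\<^sup>2 * (g z * g z))"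
  proof (rule sum.cong[OF refl])
    fix z assume "z \<in> nbrs p"
    then have "col p z" by simp
    then show "g z * (\<Sum>r\<in>nbrs z. of_bool (r \<in> W) * g r) = Q\<^sup>2 * g z - Q\<^sup>2 * (g z * g z)"
      unfolding inner[OF \<open>col p z\<close>] by algebra
  qed
  also have "\<dots> = Q\<^sup>2 * sum g (nbrs p) - Q\<^sup>2 * (\<Sum>z\<in>nbrs p. g z * g z)"
    by (simp only: sum_subtractf sum_distrib_left)
  finally have 1: "(\<Sum>r\<in>W. g r * sum g (nbrs p \<inter> nbrs r)) = Q\<^sup>2 * sum g (nbrs p) - Q\<^sup>2 * (\<Sum>z\<in>nbrs p. g z * g z)" .
  have "(\<Sum>r\<in>W. g r * sum g (nbrs p \<inter> nbrs r)) = (\<Sum>r\<in>W. (Q + 1 - Q * g p) * g r - Q * (g r * g r))"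
  proof (rule sum.cong[OF refl])
    fix r assume "r \<in> W"
    then have "Q * (g p + g r) + sum g (nbrs p \<inter> nbrs r) = Q + 1"
      unfolding Q_def W_def using p by (intro ovoid_common) auto
    then show "g r * sum g (nbrs p \<inter> nbrs r) = (Q + 1 - Q * g p) * g r - Q * (g r * g r)"
      by algebra
  qed
  also have "\<dots> = (Q + 1 - Q * g p) * sum g W - Q * (\<Sum>r\<in>W. g r * g r)"
    by (simp only: sum_subtractf sum_distrib_left)
  finally have 2: "Q\<^sup>2 * sum g (nbrs p) - Q\<^sup>2 * (\<Sum>z\<in>nbrs p. g z * g z) =
      (Q + 1 - Q * g p) * sum g W - Q * (\<Sum>r\<in>W. g r * g r)"
    unfolding 1 .
  have 3: "(\<Sum>z\<in>P. (g z)\<^sup>2) = g p * g p + (\<Sum>z\<in>nbrs p. g z * g z) + (\<Sum>z\<in>W. g z * g z)"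
    unfolding power2_eq_square by (rule split)
  have 4: "(\<Sum>z\<in>nbrs p. g z * (g z - 1)) = (\<Sum>z\<in>nbrs p. g z * g z) - sum g (nbrs p)"
    by (simp add: right_diff_distrib sum_subtractf)
  \<comment> \<open>The sums over \<open>W\<close> are eliminated by \<open>3\<close> and
    \<open>SO\<close>; the common factor \<open>Q\<close> is cancelled afterwards.\<close>
  have "Q * ((Q + 1) * (\<Sum>z\<in>nbrs p. g z * (g z - 1))) = Q * ((Q\<^sup>2 - 1) * (g p)\<^sup>2
      + (Q - 1) * (Q\<^sup>2 - 1) * g p + (\<Sum>z\<in>P. (g z)\<^sup>2) - Q ^ 3 - Q\<^sup>2 + Q - 1)"
    using 2 3 4 SO S1 by algebra
  then show ?thesis using Q unfolding Q_def by simp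
qed

end

section \<open>From the two degrees of Y to a weighted ovoid, and from there to a pencil\<close>

text \<open>\<open>X\<close> abstracts the complement of a hyperplane section. The sum of the
  degrees into \<open>Y\<close> along a line depends only on how many points of \<open>Y\<close> it
  carries, so the degrees prescribed on \<open>X\<close> determine those outside.\<close>

lemma pencil_of_card:
  assumes meets_outside: "\<And>L. L \<in> LL \<Longrightarrow> L \<inter> X \<noteq> {} \<Longrightarrow> card (L - X) = 1"
    and col_inside: "\<And>p. p \<in> P - X \<Longrightarrow> \<exists>x\<in>X. col p x"
    and X: "X \<subseteq> P" and Y: "Y \<subseteq> X"
    and card_Y: "card Y = q\<^sup>2 * (q - 1)"
    and deg_in: "\<And>y. y \<in> Y \<Longrightarrow> card (nbrs y \<inter> Y) = q - 1"
    and deg_out: "\<And>x. x \<in> X - Y \<Longrightarrow> card (nbrs x \<inter> Y) = q\<^sup>2 - q"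
  shows "\<exists>p\<in>P - X. Y = nbrs p \<inter> X"
proof -
  define Q where "Q = int q"
  have Q: "Q \<ge> 2" using order_ge_2 unfolding Q_def by simp
  have YP: "Y \<subseteq> P" using X Y by blast
  have fY: "finite Y" using YP finite_points finite_subset by blast
  have cY: "int (card Y) = Q\<^sup>2 * (Q - 1)"
    using card_Y order_ge_2 by (simp add: Q_def of_nat_diff)
  define n where "n p = int (card (nbrs p \<inter> Y))" for p
  have n_in: "n y = Q - 1" if "y \<in> Y" for y
    using deg_in[OF that] order_ge_2 by (simp add: n_def Q_def of_nat_diff)
  have n_out: "n x = Q\<^sup>2 - Q" if "x \<in> X - Y" for x
    using deg_out[OF that] order_ge_2 by (simp add: n_def Q_def of_nat_diff power2_eq_square)
  \<comment> \<open>A point of \<open>Y\<close> off \<open>L\<close> is counted once, a point of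
    \<open>Y\<close> on \<open>L\<close> is counted \<open>Q\<close> times.\<close>
  have line_sum: "sum n L = int (card Y) + (Q - 1) * int (card (L \<inter> Y))" if L: "L \<in> LL" for L
  proof -
    have "sum n L = (\<Sum>x\<in>L. \<Sum>z\<in>nbrs x. of_bool (z \<in> Y))"
      by (intro sum.cong refl) (simp only: n_def int_card_eq_sum[OF finite_nbrs])
    also have "\<dots> = (\<Sum>z\<in>P. of_bool (z \<in> Y) * int (card (nbrs z \<inter> L)))"
      using sum_times_card[OF line_subset[OF L]] by simp
    also have "\<dots> = (\<Sum>z\<in>P. of_bool (z \<in> Y) * (1 + (Q - 1) * of_bool (z \<in> L)))"
    proof (rule sum.cong[OF refl])
      fix z assume z: "z \<in> P"
      have "nbrs z \<inter> L = {x \<in> L. col x z}" using col_sym by auto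
      then show "of_bool (z \<in> Y) * int (card (nbrs z \<inter> L)) = of_bool (z \<in> Y) * (1 + (Q - 1) * of_bool (z \<in> L))"
        using card_projection[OF L z] by (simp add: Q_def)
    qed
    also have "\<dots> = (\<Sum>z\<in>Y. 1 + (Q - 1) * of_bool (z \<in> L))"
      by (rule sum_of_bool_times[OF YP])
    also have "\<dots> = int (card Y) + (Q - 1) * int (card (Y \<inter> L))"
      unfolding int_card_eq_sum[OF fY] by (simp only: sum.distrib sum_distrib_left) simp
    finally show ?thesis by (simp add: Int_commute)
  qed
  \<comment> \<open>After subtracting the known degrees at the points of \<open>L\<close> in
    \<open>X\<close>, the term \<open>Q * (Q\<^sup>2 - Q)\<close> cancels against
    \<open>card Y\<close>. Hence \<open>card (L \<inter> Y)\<close> is determined by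
    \<open>n p\<close> and is the same for all such lines on \<open>p\<close>.\<close>
  have outside: "n p = (Q\<^sup>2 - Q) * int (card (L \<inter> Y)) \<and> L - X = {p}"
    if L: "L \<in> LL" "L \<inter> X \<noteq> {}" "p \<in> L" "p \<notin> X" for L p
  proof -
    have p: "L - X = {p}"
      using meets_outside[OF L(1,2)] L(3,4) by (metis DiffI card_1_singletonE singletonD)
    define m where "m = int (card (L \<inter> Y))"
    have fL: "finite L" using finite_line[OF L(1)] .
    have parts: "L = insert p ((L \<inter> Y) \<union> (L \<inter> (X - Y)))" using p Y L by blast
    have "card L = Suc (card (L \<inter> Y) + card (L \<inter> (X - Y)))"
      by (subst parts, subst card_insert_disjoint, use fL L Y in \<open>auto intro!: card_Un_disjoint\<close>)
    then have rest: "int (card (L \<inter> (X - Y))) = Q - m"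
      using card_line[OF L(1)] unfolding m_def Q_def by simp
    have "sum n L = n p + (sum n (L \<inter> Y) + sum n (L \<inter> (X - Y)))"
      by (subst parts, subst sum.insert, use fL L Y in \<open>auto intro!: sum.union_disjoint\<close>)
    also have "sum n (L \<inter> Y) = m * (Q - 1)"
      unfolding m_def using n_in by simp
    also have "sum n (L \<inter> (X - Y)) = (Q - m) * (Q\<^sup>2 - Q)"
      unfolding rest[symmetric] using n_out by simp
    finally have "n p = (Q\<^sup>2 - Q) * m"
      using line_sum[OF L(1), folded m_def] unfolding cY by algebra
    with p show ?thesis unfolding m_def by blast
  qed
  \<comment> \<open>For \<open>p\<close> outside \<open>X\<close> this division is exact by
    \<open>outside\<close>.\<close>
  define m where "m p = n p div (Q\<^sup>2 - Q)" for p
  have QQ: "Q\<^sup>2 - Q > 0" using Q by (simp add: power2_eq_square)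
  have m_line: "m p = int (card (L \<inter> Y))" if "L \<in> LL" "L \<inter> X \<noteq> {}" "p \<in> L" "p \<notin> X" for L p
    using outside[OF that] QQ unfolding m_def by simp
  have n_eq: "n p = (Q\<^sup>2 - Q) * m p" and m_nonneg: "m p \<ge> 0" if p: "p \<in> P - X" for p
  proof -
    obtain L where "L \<in> LL" "L \<inter> X \<noteq> {}" "p \<in> L" "p \<notin> X"
      using col_inside[OF p] p unfolding col_def by blast
    then show "n p = (Q\<^sup>2 - Q) * m p" "m p \<ge> 0"
      using outside[of L p] m_line[of L p] by simp_all
  qed
  \<comment> \<open>On a line meeting \<open>X\<close>, the points of \<open>Y\<close> contribute
    \<open>m p\<close> and the single outside point \<open>p\<close> contributes
    \<open>1 - m p\<close>.\<close>
  define g where "g p = (if p \<in> X then of_bool (p \<in> Y) else 1 - m p)" for p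
  have g_X: "sum g A = int (card (A \<inter> Y))" if "A \<subseteq> X" "finite A" for A
    unfolding int_card_eq_sum[OF that(2)] using that(1) by (intro sum.cong refl) (auto simp: g_def)
  have g_line: "sum g L = 1" if L: "L \<in> LL" for L
  proof (cases "L \<inter> X = {}")
    case True
    \<comment> \<open>A line missing \<open>X\<close> misses \<open>Y\<close>, so its degree sum is
      \<open>card Y\<close>, which is \<open>(Q\<^sup>2 - Q) * Q\<close>. The \<open>m p\<close>
      then sum to \<open>Q\<close> over \<open>Q + 1\<close> points.\<close>
    have "(Q\<^sup>2 - Q) * (\<Sum>p\<in>L. m p) = sum n L"
      unfolding sum_distrib_left
    proof (rule sum.cong[OF refl])
      fix p assume "p \<in> L"
      then have "p \<in> P - X" using True line_subset[OF L] by blast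
      then show "(Q\<^sup>2 - Q) * m p = n p" using n_eq by simp
    qed
    also have "\<dots> = (Q\<^sup>2 - Q) * Q"
    proof -
      have "L \<inter> Y = {}" using True Y by blast
      then show ?thesis using line_sum[OF L] cY by (simp add: algebra_simps power2_eq_square)
    qed
    finally have "(\<Sum>p\<in>L. m p) = Q" using QQ by simp
    moreover have "sum g L = (\<Sum>p\<in>L. 1 - m p)"
      using True by (intro sum.cong) (auto simp: g_def)
    ultimately show ?thesis
      using card_line[OF L] by (simp add: sum_subtractf Q_def)
  next
    case False
    obtain p where p: "L - X = {p}" using meets_outside[OF L False] card_1_singletonE by blast
    have fL: "finite L" using finite_line[OF L] .
    have "L = insert p (L \<inter> X)" using p by blast
    then have "sum g L = g p + sum g (L \<inter> X)"
      using fL p by (metis Diff_iff IntD2 finite_Int insertI1 sum.insert)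
    also have "sum g (L \<inter> X) = int (card (L \<inter> Y))"
      using g_X[of "L \<inter> X"] fL Y by (simp add: Int_assoc Int_absorb1)
    also have "g p = 1 - int (card (L \<inter> Y))"
      using m_line[OF L False] p unfolding g_def by auto
    finally show ?thesis by simp
  qed
  have "Y \<noteq> {}" using card_Y order_ge_2 by auto
  then obtain y where "y \<in> Y" by blast
  then have yP: "y \<in> P" using YP by blast
  have total: "sum g P = Q ^ 3 + 1"
    unfolding Q_def by (rule ovoid_total[OF g_line yP])
  \<comment> \<open>Since \<open>g\<close> is 1 on \<open>Y\<close>, \<open>ovoid_nbrs\<close> makes
    each inner sum vanish. Read from the other side, the same double sum pairs \<open>g\<close> with
    the degrees \<open>n\<close> and gives the second moment of \<open>g\<close>.\<close>
  have "(\<Sum>y\<in>Y. sum g (nbrs y)) = 0"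
  proof (rule sum.neutral, rule ballI)
    fix y assume y: "y \<in> Y"
    then have "g y = 1" using Y unfolding g_def by auto
    then show "sum g (nbrs y) = 0" using ovoid_nbrs[OF g_line, of y] y YP by auto
  qed
  then have "0 = (\<Sum>z\<in>P. g z * n z)"
    using sum_times_card[OF YP, of g] unfolding n_def by simp
  \<comment> \<open>On \<open>X\<close> the weight is 0 or 1, so \<open>g z * (g z - 1)\<close>
    vanishes there; outside \<open>X\<close> the degree \<open>n z\<close> is
    \<open>(Q\<^sup>2 - Q) * (1 - g z)\<close>.\<close>
  also have "\<dots> = (\<Sum>z\<in>P. (Q - 1) * (of_bool (z \<in> Y) * 1) - (Q\<^sup>2 - Q) * (g z * (g z - 1)))"
  proof (rule sum.cong[OF refl])
    fix z assume "z \<in> P"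
    then consider "z \<in> Y" | "z \<in> X - Y" | "z \<in> P - X" by blast
    then show "g z * n z = (Q - 1) * (of_bool (z \<in> Y) * 1) - (Q\<^sup>2 - Q) * (g z * (g z - 1))"
    proof cases
      case 1
      then have "g z = 1" using Y unfolding g_def by auto
      with 1 n_in show ?thesis by simp
    next
      case 2
      then show ?thesis unfolding g_def by simp
    next
      case 3
      then have "z \<notin> Y" "g z = 1 - m z" using Y unfolding g_def by auto
      then have "g z * n z = - ((Q\<^sup>2 - Q) * (g z * (g z - 1)))"
        using n_eq[OF 3] by algebra
      with \<open>z \<notin> Y\<close> show ?thesis by simp
    qed
  qed
  also have "\<dots> = (Q - 1) * int (card Y) - (Q\<^sup>2 - Q) * (\<Sum>z\<in>P. g z * (g z - 1))"
    by (simp only: sum_subtractf sum_distrib_left[symmetric] sum_of_bool_times[OF YP]) simp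
  finally have "(Q\<^sup>2 - Q) * (\<Sum>z\<in>P. g z * (g z - 1)) = (Q\<^sup>2 - Q) * (Q * (Q - 1))"
    unfolding cY by algebra
  then have moment: "(\<Sum>z\<in>P. g z * (g z - 1)) = Q * (Q - 1)"
    using QQ by simp
  have "(\<Sum>z\<in>P. (g z)\<^sup>2) = (\<Sum>z\<in>P. g z * (g z - 1)) + sum g P"
    unfolding sum.distrib[symmetric] by (intro sum.cong refl) algebra
  then have squares: "(\<Sum>z\<in>P. (g z)\<^sup>2) = Q ^ 3 + Q\<^sup>2 - Q + 1"
    unfolding moment total by algebra
  \<comment> \<open>A point with a positive term must lie outside \<open>X\<close>, and
    \<open>m p \<ge> 0\<close> excludes \<open>g p > 1\<close>, so its weight is negative.\<close>
  have "(\<Sum>z\<in>P. g z * (g z - 1)) > 0"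
    unfolding moment using Q by simp
  then have "\<not> (\<forall>z\<in>P. g z * (g z - 1) \<le> 0)"
    using sum_nonpos[of P "\<lambda>z. g z * (g z - 1)"] not_le by blast
  then obtain p where p: "p \<in> P" "g p * (g p - 1) > 0"
    using not_le by blast
  have pX: "p \<notin> X" using p by (cases "p \<in> Y") (auto simp: g_def)
  with p have pPX: "p \<in> P - X" by blast
  have gm: "g p = 1 - m p" using pX unfolding g_def by simp
  have neg: "g p < 0"
    using p(2) m_nonneg[OF pPX] unfolding gm zero_less_mult_iff by linarith
  \<comment> \<open>No integer gives a negative term. With \<open>squares\<close> inserted, the
    constants in \<open>ovoid_second_moment\<close> cancel and leave a multiple of
    \<open>g p * (g p + Q - 1)\<close>; as \<open>g p < 0\<close>, this forces
    \<open>g p \<le> 1 - Q\<close>.\<close>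
  have "0 \<le> (\<Sum>z\<in>nbrs p. g z * (g z - 1))"
  proof (rule sum_nonneg)
    fix z
    show "0 \<le> g z * (g z - 1)" by (cases "g z \<le> 0") (auto simp: mult_nonpos_nonpos)
  qed
  then have "0 \<le> (Q + 1) * (\<Sum>z\<in>nbrs p. g z * (g z - 1))" using Q by simp
  also have "\<dots> = (Q\<^sup>2 - 1) * (g p * (g p + Q - 1))"
    using ovoid_second_moment[OF g_line p(1), folded Q_def] unfolding squares by algebra
  finally have "0 \<le> g p * (g p + Q - 1)"
    using QQ Q by (simp add: zero_le_mult_iff)
  then have mQ: "m p \<ge> Q" using neg gm unfolding zero_le_mult_iff by linarith
  \<comment> \<open>The bound equals \<open>card Y\<close>, so every point of \<open>Y\<close> is
    collinear with \<open>p\<close>.\<close>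
  then have "n p \<ge> (Q\<^sup>2 - Q) * Q"
    unfolding n_eq[OF pPX] using QQ by simp
  then have "int (card (nbrs p \<inter> Y)) \<ge> int (card Y)"
    unfolding cY n_def[symmetric] by (simp add: algebra_simps power2_eq_square)
  then have sub: "nbrs p \<inter> Y = Y"
    using fY by (intro card_seteq) auto
  have "Y = nbrs p \<inter> X"
  proof
    show "Y \<subseteq> nbrs p \<inter> X" using sub Y by blast
    show "nbrs p \<inter> X \<subseteq> Y"
    proof
      \<comment> \<open>The line joining \<open>p\<close> to \<open>x\<close> has only
        \<open>q\<close> points in \<open>X\<close> and at least \<open>q\<close> in
        \<open>Y\<close>, so all of them, \<open>x\<close> included, are in
        \<open>Y\<close>.\<close>
      fix x assume x: "x \<in> nbrs p \<inter> X"
      then obtain L where L: "L \<in> LL" "p \<in> L" "x \<in> L" unfolding nbrs_def col_def by auto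
      have LX: "L \<inter> X \<noteq> {}" using x L by blast
      have p': "L - X = {p}" using outside[OF L(1) LX L(2) pX] by blast
      have fL: "finite L" using finite_line[OF L(1)] .
      have "int (card (L \<inter> Y)) \<ge> Q" using m_line[OF L(1) LX L(2) pX] mQ by simp
      moreover have "card (L \<inter> X) = q"
      proof -
        have "L \<inter> X = L - {p}" using p' by blast
        then show ?thesis using card_line[OF L(1)] L fL by simp
      qed
      ultimately have "L \<inter> Y = L \<inter> X"
        using fL Y by (intro card_seteq) (auto simp: Q_def)
      then show "x \<in> Y" using x L by blast
    qed
  qed
  with pPX show ?thesis by blast
qed

end

section \<open>Subspaces over finite fields\<close>

lemma card_span_independent:
  fixes B :: "('a::{field,finite} ^ 'n) set"
  assumes "vec.independent B"
  shows "card (vec.span B) = CARD('a) ^ card B"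
proof -
  have "finite B" by simp
  then show ?thesis
    using assms
  proof induction
    case empty
    then show ?case by simp
  next
    case (insert b B)
    then have ind: "vec.independent B" "b \<notin> vec.span B"
      by (simp_all add: vec.independent_insert)
    let ?h = "\<lambda>(c, u). c *s b + u"
    have "vec.span (insert b B) = ?h ` (UNIV \<times> vec.span B)"
    proof (intro equalityI subsetI)
      fix x assume "x \<in> vec.span (insert b B)"
      then obtain c where "x - c *s b \<in> vec.span B" unfolding vec.span_insert by blast
      then show "x \<in> ?h ` (UNIV \<times> vec.span B)"
        by (intro image_eqI[of _ _ "(c, x - c *s b)"]) auto
    next
      fix x assume "x \<in> ?h ` (UNIV \<times> vec.span B)"
      then obtain c u where "x = c *s b + u" "u \<in> vec.span B" by auto
      then have "x - c *s b \<in> vec.span B" by simp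
      then show "x \<in> vec.span (insert b B)" unfolding vec.span_insert by blast
    qed
    moreover have "inj_on ?h (UNIV \<times> vec.span B)"
    proof (rule inj_onI, clarify)
      fix c u c' u'
      assume u: "u \<in> vec.span B" "u' \<in> vec.span B" and eq: "c *s b + u = c' *s b + u'"
      have "(c - c') *s b = u' - u"
        using eq by (simp add: vec.scale_left_diff_distrib algebra_simps)
      then have "(c - c') *s b \<in> vec.span B" using u by (simp add: vec.span_diff)
      then have "inverse (c - c') *s ((c - c') *s b) \<in> vec.span B" by (rule vec.span_scale)
      then have "c = c'" using ind(2) by (cases "c = c'") simp_all
      then show "c = c' \<and> u = u'" using eq by simp
    qed
    ultimately show ?case
      using insert ind by (simp add: card_image card_cartesian_product)
  qed
qed

lemma card_subspace:
  fixes S :: "('a::{field,finite} ^ 'n) set"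
  assumes "vec.subspace S"
  shows "card S = CARD('a) ^ vec.dim S"
proof -
  obtain B where B: "B \<subseteq> S" "vec.independent B" "S \<subseteq> vec.span B" "card B = vec.dim S"
    using vec.basis_exists by blast
  then have "vec.span B = S" using assms by (simp add: vec.span_subspace)
  then show ?thesis using card_span_independent[OF B(2)] B(4) by simp
qed

lemma card_field_gt_1: "CARD('a::{field,finite}) > 1"
proof -
  have "card {0, 1 :: 'a} \<le> CARD('a)" by (intro card_mono) auto
  then show ?thesis by simp
qed

lemma dim_eq_of_card:
  fixes S :: "('a::{field,finite} ^ 'n) set"
  assumes "vec.subspace S" "card S = CARD('a) ^ k"
  shows "vec.dim S = k"
  using card_subspace[OF assms(1)] assms(2) card_field_gt_1[where 'a='a] by simp

text \<open>\<open>S\<close> is the direct sum of the kernel and the multiples of \<open>s\<close>.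
  Together with \<open>dim_eq_of_card\<close> this replaces rank-nullity by counting.\<close>

lemma card_kernel:
  fixes S :: "('a::{field,finite} ^ 'n) set" and \<phi> :: "'a ^ 'n \<Rightarrow> 'a"
  assumes S: "vec.subspace S" and add: "\<And>u w. \<phi> (u + w) = \<phi> u + \<phi> w"
    and scale: "\<And>c u. \<phi> (c *s u) = c * \<phi> u" and s: "s \<in> S" "\<phi> s \<noteq> 0"
  shows "card S = CARD('a) * card {u \<in> S. \<phi> u = 0}"
proof -
  let ?h = "\<lambda>(c, u). c *s s + u"
  let ?K = "{u \<in> S. \<phi> u = 0}"
  have "S = ?h ` (UNIV \<times> ?K)"
  proof (intro equalityI subsetI)
    fix x assume x: "x \<in> S"
    let ?c = "\<phi> x / \<phi> s"
    have "\<phi> (x - ?c *s s) = \<phi> (x + (- ?c) *s s)" by (simp add: vec.scale_minus_left)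
    also have "\<dots> = 0" using s by (simp only: add scale) simp
    finally have "x - ?c *s s \<in> ?K" using S x s by (simp add: vec.subspace_diff vec.subspace_scale)
    then show "x \<in> ?h ` (UNIV \<times> ?K)"
      by (intro image_eqI[of _ _ "(?c, x - ?c *s s)"]) auto
  next
    fix x assume "x \<in> ?h ` (UNIV \<times> ?K)"
    then show "x \<in> S" using S s by (auto simp: vec.subspace_add vec.subspace_scale)
  qed
  then have "card S = card (?h ` (UNIV \<times> ?K))" by (rule arg_cong)
  moreover have "inj_on ?h (UNIV \<times> ?K)"
  proof (rule inj_onI, clarify)
    fix c u c' u'
    assume u: "\<phi> u = 0" "\<phi> u' = 0" and eq: "c *s s + u = c' *s s + u'"
    have "c * \<phi> s = c' * \<phi> s" using arg_cong[OF eq, of \<phi>] u by (simp add: add scale)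
    then show "c = c' \<and> u = u'" using eq s by simp
  qed
  ultimately show ?thesis
    by (simp only: card_image card_cartesian_product)
qed

section \<open>The quadrangle of an elliptic quadric\<close>

locale elliptic_quadric =
  fixes f :: "('a::{field,finite}) ^ 6 \<Rightarrow> 'a"
  assumes elliptic: "elliptic_form f"
begin

abbreviation bil :: "'a ^ 6 \<Rightarrow> 'a ^ 6 \<Rightarrow> 'a" where "bil \<equiv> polar f"

section \<open>The form and its polarization\<close>

lemma f_scale: "f (c *s v) = c\<^sup>2 * f v"
  using elliptic unfolding elliptic_form_def quadratic_form_def by blast

lemma f_zero [simp]: "f 0 = 0"
  using f_scale[of 0 0] by simp

lemma f_add: "f (v + w) = f v + f w + bil v w"
  unfolding polar_def by simp

lemma bil_sym: "bil v w = bil w v"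
  unfolding polar_def by (simp add: add.commute)

lemma bil_add_left: "bil (u + v) w = bil u w + bil v w"
  and bil_scale_left: "bil (c *s v) w = c * bil v w"
  using elliptic unfolding elliptic_form_def quadratic_form_def Vector_Spaces.linear_iff by blast+

lemma bil_add_right: "bil w (u + v) = bil w u + bil w v"
  and bil_scale_right: "bil w (c *s v) = c * bil w v"
  using bil_add_left bil_scale_left bil_sym by metis+

text \<open>\<open>f (v + v)\<close> equals both \<open>2 * f v + bil v v\<close> and
  \<open>4 * f v\<close>; no division by 2 occurs, so characteristic 2 is covered.\<close>

lemma bil_self: "f v = 0 \<Longrightarrow> bil v v = 0"
  using f_add[of v v] f_scale[of 2 v] by (simp add: vec.scale_left_distrib[of 1 1 v, simplified])

lemma nondegenerate: "f v = 0 \<Longrightarrow> v \<noteq> 0 \<Longrightarrow> \<exists>w. bil v w \<noteq> 0"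
  using elliptic unfolding elliptic_form_def nonsingular_on_def by blast

lemma ts_bil:
  assumes "totally_singular f S" "vec.subspace S" "u \<in> S" "w \<in> S"
  shows "bil u w = 0"
  using assms f_add[of u w] vec.subspace_add[of S u w] unfolding totally_singular_def by auto

definition orth :: "'a ^ 6 \<Rightarrow> ('a ^ 6) set" where
  "orth v = {u. bil v u = 0}"

lemma subspace_orth: "vec.subspace (orth v)"
  unfolding orth_def vec.subspace_def
  by (auto simp: bil_add_right bil_scale_right) (metis bil_scale_right mult_zero_left vec.scale_zero_left)

lemma ts_span_insert:
  assumes S: "vec.subspace S" "totally_singular f S" and v: "f v = 0" and orth: "\<And>u. u \<in> S \<Longrightarrow> bil v u = 0"
  shows "totally_singular f (vec.span (insert v S))"
  unfolding totally_singular_def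
proof
  fix x assume "x \<in> vec.span (insert v S)"
  then obtain c where "x - c *s v \<in> vec.span S"
    unfolding vec.span_insert by blast
  then have c: "x - c *s v \<in> S" using S(1) vec.span_eq_iff[of S] by metis
  have "f (c *s v + (x - c *s v)) = 0"
    unfolding f_add using c S(2) v orth by (simp add: f_scale bil_scale_left totally_singular_def)
  then show "f x = 0" by simp
qed

section \<open>Totally singular lines and their points\<close>

definition ts_lines :: "('a ^ 6) set set" where
  "ts_lines = {S. vec.subspace S \<and> totally_singular f S \<and> vec.dim S = 2}"

text \<open>Both facts are needed before the \<open>Max\<close> in \<open>witt_index\<close> can be
  used as a maximum.\<close>

lemma dims_of_ts: "{vec.dim S | S. vec.subspace S \<and> totally_singular f S} \<noteq> {}"
    "finite {vec.dim S | S. vec.subspace S \<and> totally_singular f S}"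
proof -
  have "vec.subspace {0 :: 'a ^ 6}" "totally_singular f {0}"
    unfolding totally_singular_def by (auto simp: vec.subspace_def)
  then show "{vec.dim S | S. vec.subspace S \<and> totally_singular f S} \<noteq> {}" by blast
  show "finite {vec.dim S | S. vec.subspace S \<and> totally_singular f S}"
    by (rule finite_subset[of _ "range vec.dim"]) auto
qed

lemma ex_ts_line: "ts_lines \<noteq> {}"
  using Max_in[OF dims_of_ts(2,1)] elliptic
  unfolding elliptic_form_def witt_index_def ts_lines_def by auto

lemma dim_ts_le_2: "vec.subspace S \<Longrightarrow> totally_singular f S \<Longrightarrow> vec.dim S \<le> 2"
  using Max_ge[OF dims_of_ts(2), of "vec.dim S"] elliptic
  unfolding elliptic_form_def witt_index_def by auto

text \<open>Otherwise \<open>v\<close> and \<open>S\<close> would span a totally singular subspace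
  of dimension 3, against Witt index 2. This is where the elliptic quadric differs from the
  hyperbolic one.\<close>

lemma ts_line_maximal:
  assumes S: "S \<in> ts_lines" and v: "f v = 0" "\<And>u. u \<in> S \<Longrightarrow> bil v u = 0"
  shows "v \<in> S"
proof (rule ccontr)
  assume "v \<notin> S"
  moreover have "vec.span S = S" using S unfolding ts_lines_def by simp
  ultimately have "v \<notin> vec.span S" by metis
  then have "vec.dim (vec.span (insert v S)) = 3"
    using S unfolding vec.dim_span vec.dim_insert ts_lines_def by simp
  moreover have "vec.dim (vec.span (insert v S)) \<le> 2"
    using S v by (intro dim_ts_le_2 ts_span_insert) (auto simp: ts_lines_def)
  ultimately show False by simp
qed

lemma ts_line_span:
  assumes "f v = 0" "f w = 0" "bil v w = 0" "v \<noteq> 0" "w \<notin> vec.span {v}"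
  shows "vec.span {v, w} \<in> ts_lines"
proof -
  have 1: "totally_singular f (vec.span {v})"
    unfolding totally_singular_def vec.span_singleton using assms by (auto simp: f_scale)
  have "bil w u = 0" if "u \<in> vec.span {v}" for u
    using that assms bil_sym[of w v] unfolding vec.span_singleton by (auto simp: bil_scale_right)
  then have "totally_singular f (vec.span (insert w (vec.span {v})))"
    using assms 1 ts_span_insert[of "vec.span {v}" w] by auto
  moreover have "vec.span (insert w (vec.span {v})) = vec.span {v, w}"
    unfolding vec.span_insert[of w "vec.span {v}"] insert_commute[of v w] vec.span_insert[of w "{v}"] vec.span_span ..
  moreover have "vec.dim (vec.span {v, w}) = 2"
    using assms unfolding vec.dim_span by (simp add: insert_commute[of v w] vec.dim_insert)
  ultimately show ?thesis unfolding ts_lines_def by simp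
qed

lemma quadric_obtain:
  assumes "p \<in> quadric f"
  obtains v where "v \<in> p" "v \<noteq> 0" "f v = 0"
proof -
  have "p \<noteq> {0}" using assms unfolding quadric_def by auto
  moreover have "0 \<in> p" using assms unfolding quadric_def by (simp add: vec.subspace_0)
  ultimately obtain v where "v \<in> p" "v \<noteq> 0" by blast
  then show ?thesis using that assms unfolding quadric_def totally_singular_def by blast
qed

lemma quadric_eq_span:
  assumes "p \<in> quadric f" "v \<in> p" "v \<noteq> 0"
  shows "p = vec.span {v}"
proof -
  have "vec.span {v} \<subseteq> p"
    using assms unfolding quadric_def by (intro vec.span_minimal) auto
  then show ?thesis
    using assms unfolding quadric_def
    by (intro vec.subspace_dim_equal[symmetric]) (auto simp: vec.dim_insert)
qed

lemma span_in_quadric: "f v = 0 \<Longrightarrow> v \<noteq> 0 \<Longrightarrow> vec.span {v} \<in> quadric f"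
  unfolding quadric_def by (simp add: vec.dim_insert) (auto simp: totally_singular_def vec.span_singleton f_scale)

lemma quadric_subset_iff:
  assumes "p \<in> quadric f" "v \<in> p" "v \<noteq> 0" "vec.subspace S"
  shows "p \<subseteq> S \<longleftrightarrow> v \<in> S"
  using quadric_eq_span[OF assms(1-3)] assms vec.span_minimal[of "{v}" S] by auto

lemma quadric_disjoint:
  assumes "p \<in> quadric f" "p' \<in> quadric f" "p \<noteq> p'"
  shows "(p - {0}) \<inter> (p' - {0}) = {}"
  using quadric_eq_span assms by blast

lemma card_quadric_point:
  assumes "p \<in> quadric f"
  shows "card p = CARD('a)" "card (p - {0}) = CARD('a) - 1"
proof -
  show "card p = CARD('a)" using assms card_subspace[of p] unfolding quadric_def by simp
  then show "card (p - {0}) = CARD('a) - 1"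
    using assms by (subst card_Diff_singleton) (auto simp: quadric_def vec.subspace_0)
qed

definition pts :: "('a ^ 6) set \<Rightarrow> ('a ^ 6) set set" where
  "pts S = {p \<in> quadric f. p \<subseteq> S}"

text \<open>The \<open>q\<^sup>2 - 1\<close> nonzero vectors of \<open>S\<close> split into
  punctured points of \<open>q - 1\<close> vectors each.\<close>

lemma card_pts:
  assumes S: "S \<in> ts_lines"
  shows "card (pts S) = CARD('a) + 1"
proof -
  have sub: "vec.subspace S" "totally_singular f S" "vec.dim S = 2" using S unfolding ts_lines_def by auto
  have "S - {0} = (\<Union>p\<in>pts S. p - {0})"
  proof (intro equalityI subsetI)
    fix v assume v: "v \<in> S - {0}"
    then have "vec.span {v} \<in> quadric f"
      using sub by (intro span_in_quadric) (auto simp: totally_singular_def)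
    moreover have "vec.span {v} \<subseteq> S" "v \<in> vec.span {v}"
      using sub v by (simp_all add: vec.span_minimal vec.span_base)
    ultimately show "v \<in> (\<Union>p\<in>pts S. p - {0})" using v unfolding pts_def by blast
  qed (auto simp: pts_def)
  also have "card \<dots> = (\<Sum>p\<in>pts S. card (p - {0}))"
    using quadric_disjoint by (intro card_UN_disjoint) (auto simp: pts_def)
  also have "\<dots> = card (pts S) * (CARD('a) - 1)"
    using card_quadric_point by (simp add: pts_def)
  finally have "card (pts S) * (CARD('a) - 1) = CARD('a)\<^sup>2 - 1"
    using card_subspace[OF sub(1)] sub by (simp add: vec.subspace_0)
  also have "\<dots> = (CARD('a) + 1) * (CARD('a) - 1)"
    by (simp add: power2_eq_square algebra_simps)
  finally have "card (pts S) * (CARD('a) - 1) = (CARD('a) + 1) * (CARD('a) - 1)" .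
  moreover have "CARD('a) - 1 \<noteq> 0" using card_field_gt_1[where 'a='a] by linarith
  ultimately show ?thesis by (simp only: mult_cancel2 simp_thms)
qed

lemma ts_line_eq:
  assumes S: "S \<in> ts_lines" "S' \<in> ts_lines" and p: "p \<noteq> p'" "p \<in> pts S" "p' \<in> pts S" "p \<in> pts S'" "p' \<in> pts S'"
  shows "S = S'"
proof -
  have P: "p \<in> quadric f" "p' \<in> quadric f" using p unfolding pts_def by auto
  obtain v where v: "v \<in> p" "v \<noteq> 0" "f v = 0" using quadric_obtain P by blast
  obtain w where w: "w \<in> p'" "w \<noteq> 0" "f w = 0" using quadric_obtain P by blast
  have "w \<notin> vec.span {v}"
    using quadric_eq_span[OF P(1) v(1,2)] quadric_disjoint[OF P p(1)] w by blast
  moreover have "bil v w = 0"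
    using ts_bil[of S v w] S p v w unfolding ts_lines_def pts_def by blast
  ultimately have L: "vec.span {v, w} \<in> ts_lines" using v w by (intro ts_line_span) auto
  have "vec.span {v, w} = T" if T: "T \<in> ts_lines" "p \<subseteq> T" "p' \<subseteq> T" for T
    using T L v w by (intro vec.subspace_dim_equal vec.span_minimal) (auto simp: ts_lines_def)
  from this[of S] this[of S'] show ?thesis using S p unfolding pts_def by auto
qed

text \<open>By maximality \<open>bil v\<close> is not identically zero on \<open>S\<close>, so its
  kernel there has dimension 1. This is the geometric core of the quadrangle axiom.\<close>

lemma ts_line_projection:
  assumes S: "S \<in> ts_lines" and v: "f v = 0" "v \<notin> S"
  shows "{u \<in> S. bil v u = 0} \<in> quadric f"
proof -
  let ?K = "{u \<in> S. bil v u = 0}"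
  have sub: "vec.subspace S" "totally_singular f S" "vec.dim S = 2" using S unfolding ts_lines_def by auto
  obtain s where s: "s \<in> S" "bil v s \<noteq> 0" using ts_line_maximal[OF S v(1)] v(2) by blast
  have "?K = S \<inter> orth v" unfolding orth_def by auto
  then have K: "vec.subspace ?K"
    using vec.subspace_inter[OF sub(1) subspace_orth[of v]] by simp
  have "card S = CARD('a) * card ?K"
    by (rule card_kernel[of _ "bil v", OF sub(1) _ _ s]) (simp_all add: bil_add_right bil_scale_right)
  then have "card ?K = CARD('a) ^ 1"
    using card_subspace[OF sub(1)] sub(3) by (simp add: power2_eq_square)
  then have "vec.dim ?K = 1" by (rule dim_eq_of_card[OF K])
  with K sub(2) show ?thesis unfolding quadric_def totally_singular_def by auto
qed

text \<open>Any totally singular line supplies \<open>x\<close>: another point of it if it contains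
  \<open>v\<close>, the projection of \<open>v\<close> onto it otherwise.\<close>

lemma ex_orthogonal_singular:
  assumes v: "f v = 0" "v \<noteq> 0"
  shows "\<exists>x. f x = 0 \<and> bil v x = 0 \<and> x \<notin> vec.span {v}"
proof -
  obtain S where S: "S \<in> ts_lines" using ex_ts_line by blast
  then have sub: "vec.subspace S" "totally_singular f S" "vec.dim S = 2" unfolding ts_lines_def by auto
  show ?thesis
  proof (cases "v \<in> S")
    case True
    have "\<not> S \<subseteq> vec.span {v}"
      using vec.dim_subset[of S "vec.span {v}"] sub(3) by (auto simp: vec.dim_insert split: if_splits)
    then show ?thesis using True ts_bil[OF sub(2,1)] sub(2) unfolding totally_singular_def by blast
  next
    case False
    obtain k where k: "k \<in> S" "bil v k = 0" "k \<noteq> 0" "f k = 0"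
      using quadric_obtain[OF ts_line_projection[OF S v(1) False]] by blast
    have "k \<notin> vec.span {v}"
    proof
      assume "k \<in> vec.span {v}"
      then obtain c where c: "k = c *s v" unfolding vec.span_singleton by blast
      then have "v = inverse c *s k" using k(3) by (cases "c = 0") auto
      then show False using False k(1) vec.subspace_scale[OF sub(1)] by blast
    qed
    with k show ?thesis by blast
  qed
qed

section \<open>Counting the totally singular lines through a point\<close>

definition sing :: "'a ^ 6 \<Rightarrow> ('a ^ 6) set" where
  "sing v = {w. f w = 0 \<and> bil v w = 0}"

lemma card_orth:
  assumes "f v = 0" "v \<noteq> 0"
  shows "card (orth v) = CARD('a) ^ 5"
proof -
  obtain s where s: "bil v s \<noteq> 0" using nondegenerate assms by blast
  have "card (UNIV :: ('a ^ 6) set) = CARD('a) * card {u \<in> UNIV. bil v u = 0}"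
    by (rule card_kernel[of _ "bil v", OF vec.subspace_UNIV]) (use s in \<open>simp_all add: bil_add_right bil_scale_right\<close>)
  moreover have "card (UNIV :: ('a ^ 6) set) = CARD('a) * CARD('a) ^ 5"
    by (simp add: numeral_eq_Suc)
  ultimately show ?thesis unfolding orth_def by simp
qed

text \<open>Vectors of \<open>sing v\<close> orthogonal to \<open>x\<close> form the line spanned by
  \<open>v\<close> and \<open>x\<close>, by maximality. Among the vectors \<open>u\<close> of
  \<open>orth v\<close> not orthogonal to \<open>x\<close>, each coset of the multiples of
  \<open>x\<close> contains exactly one singular vector, since \<open>f (u + a *s x)\<close> is
  affine in \<open>a\<close> with nonzero slope.\<close>

lemma card_sing:
  assumes v: "f v = 0" "v \<noteq> 0" and x: "f x = 0" "bil v x = 0" "x \<notin> vec.span {v}"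
  shows "card {w \<in> sing v. bil x w = 0} = CARD('a)\<^sup>2" "card {w \<in> sing v. bil x w \<noteq> 0} = CARD('a) ^ 4 - CARD('a) ^ 3"
proof -
  have L: "vec.span {v, x} \<in> ts_lines" using v x by (intro ts_line_span) auto
  then have sub: "vec.subspace (vec.span {v, x})" "totally_singular f (vec.span {v, x})" "vec.dim (vec.span {v, x}) = 2"
    unfolding ts_lines_def by auto
  have vx: "v \<in> vec.span {v, x}" "x \<in> vec.span {v, x}" by (simp_all add: vec.span_base)
  have "{w \<in> sing v. bil x w = 0} = vec.span {v, x}"
  proof (intro equalityI subsetI)
    fix w assume w: "w \<in> {w \<in> sing v. bil x w = 0}"
    then have "vec.span {v, x} \<subseteq> orth w"
      using bil_sym by (intro vec.span_minimal subspace_orth) (auto simp: orth_def sing_def)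
    then show "w \<in> vec.span {v, x}"
      using w by (intro ts_line_maximal[OF L]) (auto simp: orth_def sing_def)
  next
    fix w assume "w \<in> vec.span {v, x}"
    then show "w \<in> {w \<in> sing v. bil x w = 0}"
      using ts_bil[OF sub(2,1)] vx sub(2) unfolding sing_def totally_singular_def by blast
  qed
  then show "card {w \<in> sing v. bil x w = 0} = CARD('a)\<^sup>2"
    using card_subspace[OF sub(1)] sub(3) by simp
  have "\<exists>s\<in>orth v. bil x s \<noteq> 0"
  proof (rule ccontr)
    assume "\<not> (\<exists>s\<in>orth v. bil x s \<noteq> 0)"
    then have "orth v \<subseteq> orth x" unfolding orth_def by blast
    moreover have "x \<noteq> 0" using x(3) vec.span_zero by blast
    then have "card (orth x) = card (orth v)" using card_orth v x by simp
    ultimately have eq: "orth v = orth x" by (intro card_subset_eq) auto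
    obtain s where s: "bil v s \<noteq> 0" using nondegenerate v by blast
    \<comment> \<open>\<open>bil x\<close> and \<open>bil v\<close> have equal kernels and are
      proportional. The coefficient is chosen so that \<open>bil y s = 0\<close>; then
      \<open>y\<close> is a nonzero singular vector in the radical.\<close>
    define y where "y = x + (- (bil x s / bil v s)) *s v"
    have "bil x v = 0" using x bil_sym by simp
    then have "f y = 0" unfolding y_def f_add f_scale bil_scale_right using v x by simp
    moreover have "y \<noteq> 0"
    proof
      assume "y = 0"
      then have "x = (bil x s / bil v s) *s v" unfolding y_def by (simp add: vec.scale_minus_left)
      then show False using x(3) vec.span_base vec.span_scale by (metis singletonI)
    qed
    moreover have "bil y u = 0" for u
    proof -
      define c where "c = bil v u / bil v s"
      have "bil v (u + (- c) *s s) = 0" unfolding bil_add_right bil_scale_right c_def using s by simp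
      then have "bil x (u + (- c) *s s) = 0" using eq unfolding orth_def by blast
      then have "bil x u = c * bil x s" unfolding bil_add_right bil_scale_right by simp
      then show ?thesis unfolding y_def bil_add_left bil_scale_left c_def using s by simp
    qed
    ultimately show False using nondegenerate by blast
  qed
  then obtain s where s: "s \<in> orth v" "bil x s \<noteq> 0" by blast
  let ?K = "{u \<in> orth v. bil x u = 0}"
  let ?A = "{u \<in> orth v. bil x u \<noteq> 0}"
  let ?Z = "{w \<in> sing v. bil x w \<noteq> 0}"
  have "card (orth v) = CARD('a) * card ?K"
    by (rule card_kernel[of _ "bil x", OF subspace_orth _ _ s]) (simp_all add: bil_add_right bil_scale_right)
  then have K: "card ?K = CARD('a) ^ 4"
    using card_orth[OF v] by (simp add: numeral_eq_Suc)
  have "?A = orth v - ?K" by blast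
  then have A: "card ?A = CARD('a) ^ 5 - CARD('a) ^ 4"
    using card_Diff_subset[of ?K "orth v"] K card_orth[OF v] by simp
  let ?h = "\<lambda>(a, w). w + a *s x"
  have "bil x x = 0" using bil_self x by blast
  have "?A = ?h ` (UNIV \<times> ?Z)"
  proof (intro equalityI subsetI)
    fix u assume u: "u \<in> ?A"
    \<comment> \<open>The root of the affine function, up to sign.\<close>
    define a where "a = f u / bil x u"
    have "f (u + (- a) *s x) = 0"
      unfolding f_add f_scale bil_scale_right bil_sym[of u x] a_def using u x by simp
    then have "u + (- a) *s x \<in> ?Z"
      unfolding sing_def mem_Collect_eq bil_add_right bil_scale_right
      using u x \<open>bil x x = 0\<close> by (simp add: orth_def)
    then show "u \<in> ?h ` (UNIV \<times> ?Z)"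
      by (intro image_eqI[of _ _ "(a, u + (- a) *s x)"]) (auto simp: vec.scale_minus_left)
  next
    fix u assume "u \<in> ?h ` (UNIV \<times> ?Z)"
    then show "u \<in> ?A"
      using x \<open>bil x x = 0\<close> by (auto simp: sing_def orth_def bil_add_right bil_scale_right)
  qed
  then have "card ?A = card (?h ` (UNIV \<times> ?Z))" by (rule arg_cong)
  moreover have "inj_on ?h (UNIV \<times> ?Z)"
  proof (rule inj_onI, clarify)
    fix a w a' w'
    assume w: "w \<in> sing v" "w' \<in> sing v" "bil x w \<noteq> 0" and eq: "w + a *s x = w' + a' *s x"
    have "bil x w = bil x w'"
      using arg_cong[OF eq, of "bil x"] \<open>bil x x = 0\<close> by (simp add: bil_add_right bil_scale_right)
    moreover have "a * bil x w = a' * bil x w'"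
      using arg_cong[OF eq, of f] w x by (simp add: f_add f_scale bil_scale_right sing_def bil_sym[of _ x])
    ultimately show "a = a' \<and> w = w'" using w eq by simp
  qed
  ultimately have "card ?A = CARD('a) * card ?Z"
    by (simp only: card_image card_cartesian_product)
  then have "CARD('a) * card ?Z = CARD('a) * (CARD('a) ^ 4 - CARD('a) ^ 3)"
    unfolding A by (simp add: numeral_eq_Suc algebra_simps)
  then show "card ?Z = CARD('a) ^ 4 - CARD('a) ^ 3" by simp
qed

text \<open>The lines through \<open>p\<close>, with \<open>p\<close> removed, partition
  \<open>sing v - p\<close> into classes of \<open>q\<^sup>2 - q\<close> vectors, and
  \<open>card_sing\<close> gives the size of \<open>sing v\<close>.\<close>

lemma card_ts_lines_through:
  assumes p: "p \<in> quadric f"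
  shows "card {S \<in> ts_lines. p \<subseteq> S} = CARD('a)\<^sup>2 + 1"
proof -
  let ?q = "CARD('a)"
  let ?M = "{S \<in> ts_lines. p \<subseteq> S}"
  obtain v where v: "v \<in> p" "v \<noteq> 0" "f v = 0" using quadric_obtain[OF p] by blast
  have pv: "p = vec.span {v}" by (rule quadric_eq_span[OF p v(1,2)])
  obtain x where x: "f x = 0" "bil v x = 0" "x \<notin> vec.span {v}"
    using ex_orthogonal_singular v by blast
  have "sing v = {w \<in> sing v. bil x w = 0} \<union> {w \<in> sing v. bil x w \<noteq> 0}" by blast
  moreover have "card \<dots> = ?q\<^sup>2 + (?q ^ 4 - ?q ^ 3)"
    using card_sing[OF v(3,2) x] by (subst card_Un_disjoint) auto
  ultimately have cs: "card (sing v) = ?q\<^sup>2 + (?q ^ 4 - ?q ^ 3)" by metis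
  have "bil v v = 0" using bil_self v by blast
  then have psub: "p \<subseteq> sing v"
    unfolding pv vec.span_singleton using v by (auto simp: sing_def f_scale bil_scale_right)
  have "sing v - p = (\<Union>S\<in>?M. S - p)"
  proof (intro equalityI subsetI)
    fix w assume w: "w \<in> sing v - p"
    then have "vec.span {v, w} \<in> ts_lines"
      using v pv by (intro ts_line_span) (auto simp: sing_def)
    moreover have "p \<subseteq> vec.span {v, w}" unfolding pv by (intro vec.span_mono) auto
    moreover have "w \<in> vec.span {v, w}" by (simp add: vec.span_base)
    ultimately show "w \<in> (\<Union>S\<in>?M. S - p)" using w by blast
  next
    fix w assume "w \<in> (\<Union>S\<in>?M. S - p)"
    then obtain S where S: "S \<in> ts_lines" "p \<subseteq> S" "w \<in> S" "w \<notin> p" by blast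
    then have sub: "vec.subspace S" "totally_singular f S" unfolding ts_lines_def by auto
    have "bil v w = 0" using ts_bil[OF sub(2,1)] S v by blast
    then show "w \<in> sing v - p" using S sub unfolding sing_def totally_singular_def by blast
  qed
  moreover have "card (\<Union>S\<in>?M. S - p) = (\<Sum>S\<in>?M. card (S - p))"
  proof (rule card_UN_disjoint)
    show "\<forall>S\<in>?M. \<forall>S'\<in>?M. S \<noteq> S' \<longrightarrow> (S - p) \<inter> (S' - p) = {}"
    proof (intro ballI impI, rule ccontr)
      fix S S' assume S: "S \<in> ?M" "S' \<in> ?M" "S \<noteq> S'" and "(S - p) \<inter> (S' - p) \<noteq> {}"
      then obtain w where w: "w \<in> S" "w \<in> S'" "w \<notin> p" by blast
      have sub: "vec.subspace S" "vec.subspace S'" "totally_singular f S"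
        using S unfolding ts_lines_def by auto
      have "w \<noteq> 0" using w(3) p unfolding quadric_def by (auto simp: vec.subspace_0)
      then have sw: "vec.span {w} \<in> quadric f"
        using w sub unfolding totally_singular_def by (intro span_in_quadric) auto
      have "vec.span {w} \<subseteq> S" "vec.span {w} \<subseteq> S'"
        using w sub by (simp_all add: vec.span_minimal)
      moreover have "p \<noteq> vec.span {w}" using w(3) vec.span_base by blast
      ultimately have "S = S'"
        using ts_line_eq[of S S' p "vec.span {w}"] S p sw unfolding pts_def by blast
      with S show False by blast
    qed
  qed auto
  moreover have "card (S - p) = ?q\<^sup>2 - ?q" if "S \<in> ?M" for S
    using that card_subspace[of S] card_quadric_point(1)[OF p]
    by (subst card_Diff_subset) (auto simp: ts_lines_def)
  ultimately have "card (sing v - p) = card ?M * (?q\<^sup>2 - ?q)" by simp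
  moreover have "card (sing v - p) = ?q\<^sup>2 + (?q ^ 4 - ?q ^ 3) - ?q"
    using psub cs card_quadric_point(1)[OF p] by (subst card_Diff_subset) auto
  moreover have "?q\<^sup>2 + (?q ^ 4 - ?q ^ 3) - ?q = (?q\<^sup>2 + 1) * (?q\<^sup>2 - ?q)"
  proof -
    have le: "?q ^ 3 \<le> ?q ^ 4" "?q \<le> ?q\<^sup>2"
      using card_field_gt_1[where 'a='a] by (simp_all add: power_increasing power2_eq_square)
    have "int (?q\<^sup>2 + (?q ^ 4 - ?q ^ 3) - ?q) = int ((?q\<^sup>2 + 1) * (?q\<^sup>2 - ?q))"
      using le by (simp add: of_nat_diff algebra_simps numeral_eq_Suc)
    then show ?thesis by (simp only: of_nat_eq_iff)
  qed
  ultimately have "card ?M * (?q\<^sup>2 - ?q) = (?q\<^sup>2 + 1) * (?q\<^sup>2 - ?q)" by simp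
  moreover have "?q\<^sup>2 - ?q \<noteq> 0"
    using card_field_gt_1[where 'a='a] by (simp add: power2_eq_square)
  ultimately show ?thesis by (simp only: mult_cancel2 simp_thms)
qed

text \<open>Lines of the quadrangle are sets of points; this carries the count of subspaces over to
  them.\<close>

lemma inj_on_pts: "inj_on pts ts_lines"
proof -
  have "S \<subseteq> S'" if S: "S \<in> ts_lines" "S' \<in> ts_lines" "pts S = pts S'" for S S'
  proof
    fix u assume u: "u \<in> S"
    have sub: "vec.subspace S" "vec.subspace S'" "totally_singular f S"
      using S unfolding ts_lines_def by auto
    show "u \<in> S'"
    proof (cases "u = 0")
      case True
      then show ?thesis using sub by (simp add: vec.subspace_0)
    next
      case False
      then have "vec.span {u} \<in> quadric f"
        using u sub unfolding totally_singular_def by (intro span_in_quadric) auto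
      then have "vec.span {u} \<in> pts S"
        using u sub by (simp add: pts_def vec.span_minimal)
      then have "vec.span {u} \<subseteq> S'" using S(3) unfolding pts_def by blast
      then show ?thesis using vec.span_base by blast
    qed
  qed
  then show ?thesis by (intro inj_onI) (metis subset_antisym)
qed

section \<open>Collinearity as orthogonality, and the quadrangle axioms\<close>

lemma collinear_iff_bil:
  assumes "p \<in> quadric f" "p' \<in> quadric f" "v \<in> p" "v \<noteq> 0" "w \<in> p'" "w \<noteq> 0"
  shows "collinear_pts f p p' \<longleftrightarrow> p \<noteq> p' \<and> bil v w = 0"
proof -
  have "p' \<subseteq> perp f p \<longleftrightarrow> bil v w = 0"
  proof
    assume "p' \<subseteq> perp f p"
    then show "bil v w = 0" using assms unfolding perp_def by blast
  next
    assume vw: "bil v w = 0"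
    have "bil a b = 0" if "a \<in> p" "b \<in> p'" for a b
      using that vw quadric_eq_span[OF assms(1,3,4)] quadric_eq_span[OF assms(2,5,6)]
      by (auto simp: vec.span_singleton bil_scale_left bil_scale_right)
    then show "p' \<subseteq> perp f p" unfolding perp_def by blast
  qed
  then show ?thesis unfolding collinear_pts_def by blast
qed

lemma ex_ts_line_iff:
  assumes p: "p \<in> quadric f" "p' \<in> quadric f" "p \<noteq> p'"
  shows "(\<exists>S\<in>ts_lines. p \<subseteq> S \<and> p' \<subseteq> S) \<longleftrightarrow> collinear_pts f p p'"
proof -
  obtain v where v: "v \<in> p" "v \<noteq> 0" "f v = 0" using quadric_obtain p by blast
  obtain w where w: "w \<in> p'" "w \<noteq> 0" "f w = 0" using quadric_obtain p by blast
  have pv: "p = vec.span {v}" "p' = vec.span {w}"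
    using quadric_eq_span p v w by blast+
  have iff: "collinear_pts f p p' \<longleftrightarrow> bil v w = 0"
    using collinear_iff_bil[OF p(1,2) v(1,2) w(1,2)] p(3) by blast
  show ?thesis unfolding iff
  proof
    assume "\<exists>S\<in>ts_lines. p \<subseteq> S \<and> p' \<subseteq> S"
    then show "bil v w = 0" using v w ts_bil unfolding ts_lines_def by blast
  next
    assume "bil v w = 0"
    moreover have "w \<notin> vec.span {v}" using quadric_disjoint[OF p] w pv by blast
    ultimately have "vec.span {v, w} \<in> ts_lines" using v w by (intro ts_line_span)
    moreover have "p \<subseteq> vec.span {v, w}" "p' \<subseteq> vec.span {v, w}"
      unfolding pv by (intro vec.span_mono; auto)+
    ultimately show "\<exists>S\<in>ts_lines. p \<subseteq> S \<and> p' \<subseteq> S" by blast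
  qed
qed

lemma ts_line_unique_projection:
  assumes p: "p \<in> quadric f" and S: "S \<in> ts_lines" "\<not> p \<subseteq> S"
  shows "\<exists>!x. x \<in> pts S \<and> (\<exists>T\<in>ts_lines. p \<subseteq> T \<and> x \<subseteq> T)"
proof -
  obtain v where v: "v \<in> p" "v \<noteq> 0" "f v = 0" using quadric_obtain p by blast
  have sub: "vec.subspace S" using S unfolding ts_lines_def by blast
  have vS: "v \<notin> S" using quadric_subset_iff[OF p v(1,2) sub] S by blast
  let ?K = "{u \<in> S. bil v u = 0}"
  have K: "?K \<in> quadric f" by (rule ts_line_projection[OF S(1) v(3) vS])
  obtain k where k: "k \<in> ?K" "k \<noteq> 0" using quadric_obtain[OF K] by blast
  have pK: "p \<noteq> ?K" using v vS by blast
  have iff: "x = ?K \<longleftrightarrow> (\<exists>T\<in>ts_lines. p \<subseteq> T \<and> x \<subseteq> T)" if x: "x \<in> pts S" for x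
  proof -
    have xq: "x \<in> quadric f" "x \<subseteq> S" using x unfolding pts_def by auto
    have px: "p \<noteq> x" using xq v vS by blast
    obtain w where w: "w \<in> x" "w \<noteq> 0" using quadric_obtain xq by blast
    have "x = ?K \<longleftrightarrow> w \<in> ?K"
      using quadric_eq_span[OF xq(1) w] quadric_eq_span[OF K _ w(2)] w by blast
    also have "\<dots> \<longleftrightarrow> bil v w = 0" using w xq by blast
    also have "\<dots> \<longleftrightarrow> collinear_pts f p x"
      using collinear_iff_bil[OF p xq(1) v(1,2) w] px by blast
    finally show ?thesis using ex_ts_line_iff[OF p xq(1) px] by blast
  qed
  have KS: "?K \<in> pts S" using K unfolding pts_def by blast
  show ?thesis
  proof (rule ex1I[of _ ?K])
    show "?K \<in> pts S \<and> (\<exists>T\<in>ts_lines. p \<subseteq> T \<and> ?K \<subseteq> T)"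
      using KS iff[OF KS] by (simp only: simp_thms)
    show "x = ?K" if "x \<in> pts S \<and> (\<exists>T\<in>ts_lines. p \<subseteq> T \<and> x \<subseteq> T)" for x
      using that iff[of x] by (simp only: simp_thms)
  qed
qed

sublocale gen_quadrangle "quadric f" "pts ` ts_lines" "CARD('a)"
proof
  show "finite (quadric f)" by simp
  show "2 \<le> CARD('a)" using card_field_gt_1[where 'a='a] by simp
  fix L assume L: "L \<in> pts ` ts_lines"
  show "L \<subseteq> quadric f" using L unfolding pts_def by blast
  show "card L = CARD('a) + 1" using L card_pts by blast
next
  fix p assume p: "p \<in> quadric f"
  have "{L \<in> pts ` ts_lines. p \<in> L} = pts ` {S \<in> ts_lines. p \<subseteq> S}"
    using p unfolding pts_def by blast
  moreover have "inj_on pts {S \<in> ts_lines. p \<subseteq> S}"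
    by (rule inj_on_subset[OF inj_on_pts]) blast
  ultimately show "card {L \<in> pts ` ts_lines. p \<in> L} = CARD('a)\<^sup>2 + 1"
    using card_ts_lines_through[OF p] by (simp add: card_image)
next
  fix L M x y
  assume "L \<in> pts ` ts_lines" "M \<in> pts ` ts_lines" "x \<noteq> y" "x \<in> L" "y \<in> L" "x \<in> M" "y \<in> M"
  then show "L = M" using ts_line_eq by blast
next
  fix p L assume p: "p \<in> quadric f" and L: "L \<in> pts ` ts_lines" "p \<notin> L"
  then obtain S where S: "S \<in> ts_lines" "L = pts S" by blast
  have "\<not> p \<subseteq> S" using p L S unfolding pts_def by blast
  from ts_line_unique_projection[OF p S(1) this]
  have ex1: "\<exists>!x. x \<in> L \<and> (\<exists>T\<in>ts_lines. p \<subseteq> T \<and> x \<subseteq> T)" unfolding S(2) .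
  have "x \<in> L \<and> (\<exists>T\<in>ts_lines. p \<subseteq> T \<and> x \<subseteq> T) \<longleftrightarrow> x \<in> L \<and> (\<exists>M\<in>pts ` ts_lines. p \<in> M \<and> x \<in> M)" for x
  proof (rule conj_cong[OF refl])
    assume "x \<in> L"
    then have "x \<in> quadric f" using S unfolding pts_def by blast
    with p show "(\<exists>T\<in>ts_lines. p \<subseteq> T \<and> x \<subseteq> T) \<longleftrightarrow> (\<exists>M\<in>pts ` ts_lines. p \<in> M \<and> x \<in> M)"
      by (simp add: pts_def)
  qed
  with ex1 show "\<exists>!x. x \<in> L \<and> (\<exists>M\<in>pts ` ts_lines. p \<in> M \<and> x \<in> M)" by (simp only:)
qed

lemma col_iff:
  assumes "p \<in> quadric f" "p' \<in> quadric f"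
  shows "col p p' \<longleftrightarrow> collinear_pts f p p'"
proof (cases "p = p'")
  case True
  then show ?thesis by (simp add: collinear_pts_def)
next
  case False
  then show ?thesis
    using ex_ts_line_iff[OF assms False] assms unfolding col_def by (simp add: pts_def)
qed

section \<open>The hyperplane section\<close>

lemma ts_line_Int_hyperplane:
  assumes H: "is_hyperplane H" and S: "S \<in> ts_lines" "\<not> S \<subseteq> H"
  shows "S \<inter> H \<in> quadric f"
proof -
  have sub: "vec.subspace S" "totally_singular f S" "vec.dim S = 2" "vec.subspace H" "vec.dim H = 5"
    using S H unfolding ts_lines_def is_hyperplane_def by auto
  have SH: "vec.subspace (S \<inter> H)" using sub by (simp add: vec.subspace_inter)
  have "vec.dim {x + y |x y. x \<in> S \<and> y \<in> H} \<le> 6"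
    using dim_subset_UNIV_cart_gen[of "{x + y |x y. x \<in> S \<and> y \<in> H}"] by simp
  then have "vec.dim (S \<inter> H) \<ge> 1"
    using vec.dim_sums_Int[OF sub(1,4)] sub by linarith
  moreover have "\<not> vec.dim (S \<inter> H) \<ge> 2"
    using vec.subspace_dim_equal[OF SH sub(1)] sub(3) S(2) by auto
  ultimately have "vec.dim (S \<inter> H) = 1" by linarith
  then show ?thesis using SH sub(2) unfolding quadric_def totally_singular_def by blast
qed

text \<open>
  If \<open>w\<close> is singular and \<open>u\<close> is not orthogonal to \<open>w\<close>, then some \<open>u + a w\<close> is singular.
\<close>
lemma ex_singular_outside:
  assumes H: "is_hyperplane H" "nonsingular_on f H" and v: "v \<in> H" "f v = 0" "v \<noteq> 0"
  shows "\<exists>z\<in>sing v. z \<notin> H"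
proof (rule ccontr)
  assume "\<not> (\<exists>z\<in>sing v. z \<notin> H)"
  then have inside: "sing v \<subseteq> H" by blast
  have sub: "vec.subspace H" "vec.dim H = 5" using H unfolding is_hyperplane_def by auto
  \<comment> \<open>Equality of \<open>orth v\<close> and \<open>H\<close> would put the singular
    vector \<open>v\<close> into the radical of the form on \<open>H\<close>.\<close>
  have "\<not> orth v \<subseteq> H"
  proof
    assume "orth v \<subseteq> H"
    moreover have "card (orth v) = card H" using card_orth v card_subspace[OF sub(1)] sub(2) by simp
    ultimately have "orth v = H" by (intro card_subset_eq) auto
    then show False using H(2) v unfolding nonsingular_on_def orth_def by blast
  qed
  then obtain u where u: "u \<in> orth v" "u \<notin> H" by blast
  obtain x where x: "f x = 0" "bil v x = 0" "x \<notin> vec.span {v}"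
    using ex_orthogonal_singular v by blast
  have "CARD('a) ^ 3 < CARD('a) ^ 4"
    using card_field_gt_1[where 'a='a] by (intro power_strict_increasing) auto
  then have "{w \<in> sing v. bil x w \<noteq> 0} \<noteq> {}"
    using card_sing(2)[OF v(2,3) x] by (metis card.empty not_less zero_less_diff order_refl)
  then obtain w where w: "w \<in> sing v" "bil x w \<noteq> 0" by blast
  have xs: "x \<in> sing v" using x unfolding sing_def by blast
  \<comment> \<open>If \<open>u\<close> is orthogonal to \<open>w\<close>, it is replaced by
    \<open>u + x\<close>; as \<open>x\<close> lies in \<open>sing v\<close> and hence in
    \<open>H\<close>, the new vector stays in \<open>orth v\<close> and outside
    \<open>H\<close>.\<close>
  have "bil u w = 0 \<Longrightarrow> bil (u + x) w \<noteq> 0" using w by (simp add: bil_add_left)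
  moreover have "u + x \<notin> H"
    using u(2) xs inside vec.subspace_diff[OF sub(1), of "u + x" x] by auto
  moreover have "u + x \<in> orth v"
    using u xs by (simp add: orth_def sing_def bil_add_right)
  ultimately obtain y where y: "y \<in> orth v" "y \<notin> H" "bil y w \<noteq> 0" using u by blast
  \<comment> \<open>The multiple of \<open>w\<close> makes \<open>z\<close> singular. Since
    \<open>w\<close> lies in \<open>H\<close>, \<open>z\<close> in \<open>H\<close> would pull
    \<open>y\<close> into \<open>H\<close> as well.\<close>
  define z where "z = y + (- f y / bil y w) *s w"
  have "z \<in> sing v"
    unfolding z_def sing_def mem_Collect_eq f_add f_scale bil_scale_right bil_add_right
    using y w by (simp add: sing_def orth_def)
  then have "z \<in> H" "w \<in> H" using inside w by blast+
  moreover have "y = z - (- f y / bil y w) *s w" unfolding z_def by simp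
  ultimately have "y \<in> H" using sub(1) by (metis vec.subspace_diff vec.subspace_scale)
  then show False using y by blast
qed

text \<open>Of the two geometric conditions in \<open>pencil_of_card\<close>, the first holds
  because a totally singular line not inside \<open>H\<close> meets \<open>H\<close> in one point,
  and the second is \<open>ex_singular_outside\<close>.\<close>

lemma pencil_of_card_pw:
  assumes H: "parabolic_section f H" and Y: "Y \<subseteq> pw_points f H"
    and card_Y: "card Y = CARD('a)\<^sup>2 * (CARD('a) - 1)"
    and deg_in: "\<forall>u\<in>Y. card {v \<in> Y. collinear_pts f u v} = CARD('a) - 1"
    and deg_out: "\<forall>u\<in>pw_points f H - Y. card {v \<in> Y. collinear_pts f u v} = CARD('a)\<^sup>2 - CARD('a)"
  shows "\<exists>p\<in>quadric f. p \<subseteq> H \<and> Y = {x \<in> pw_points f H. collinear_pts f x p}"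
proof -
  let ?X = "pw_points f H"
  have hyp: "is_hyperplane H" "nonsingular_on f H" using H unfolding parabolic_section_def by auto
  have subH: "vec.subspace H" using hyp unfolding is_hyperplane_def by blast
  have X: "?X \<subseteq> quadric f" unfolding pw_points_def by blast
  have nb: "nbrs u \<inter> Y = {v \<in> Y. collinear_pts f u v}" if "u \<in> ?X" for u
  proof -
    have "col u v \<longleftrightarrow> collinear_pts f u v" if "v \<in> Y" for v
      using that \<open>u \<in> ?X\<close> X Y by (intro col_iff) blast+
    then show ?thesis by auto
  qed
  have "\<exists>p\<in>quadric f - ?X. Y = nbrs p \<inter> ?X"
  proof (rule pencil_of_card[OF _ _ X Y card_Y])
    fix L assume "L \<in> pts ` ts_lines" and LX: "L \<inter> ?X \<noteq> {}"
    then obtain S where S: "S \<in> ts_lines" "L = pts S" by blast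
    have "\<not> S \<subseteq> H" using LX S unfolding pts_def pw_points_def by blast
    then have SH: "S \<inter> H \<in> quadric f" by (rule ts_line_Int_hyperplane[OF hyp(1) S(1)])
    have "p = S \<inter> H" if p: "p \<in> quadric f" "p \<subseteq> S" "p \<subseteq> H" for p
    proof -
      obtain v where "v \<in> p" "v \<noteq> 0" using quadric_obtain[OF p(1)] by blast
      then show ?thesis using quadric_disjoint[OF p(1) SH] p by blast
    qed
    then have "L - ?X = {S \<inter> H}"
      using SH unfolding S(2) pts_def pw_points_def by blast
    then show "card (L - ?X) = 1" by simp
  next
    fix p assume "p \<in> quadric f - ?X"
    then have p: "p \<in> quadric f" "p \<subseteq> H" unfolding pw_points_def by auto
    obtain v where v: "v \<in> p" "v \<noteq> 0" "f v = 0" using quadric_obtain[OF p(1)] by blast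
    then obtain z where z: "f z = 0" "bil v z = 0" "z \<notin> H"
      using ex_singular_outside[OF hyp, of v] p unfolding sing_def by blast
    then have "z \<noteq> 0" using subH vec.subspace_0 by blast
    then have zq: "vec.span {z} \<in> quadric f" "z \<in> vec.span {z}"
      using z by (simp_all add: span_in_quadric vec.span_base)
    then have "vec.span {z} \<in> ?X" "p \<noteq> vec.span {z}" using z p unfolding pw_points_def by blast+
    moreover from this have "col p (vec.span {z})"
      using col_iff[OF p(1) zq(1)] collinear_iff_bil[OF p(1) zq(1) v(1,2) zq(2) \<open>z \<noteq> 0\<close>] z by blast
    ultimately show "\<exists>x\<in>?X. col p x" by blast
  next
    fix y assume "y \<in> Y"
    then show "card (nbrs y \<inter> Y) = CARD('a) - 1" using deg_in Y nb[of y] by auto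
  next
    fix x assume "x \<in> ?X - Y"
    then show "card (nbrs x \<inter> Y) = CARD('a)\<^sup>2 - CARD('a)" using deg_out nb[of x] by auto
  qed
  then obtain p where p: "p \<in> quadric f - ?X" "Y = nbrs p \<inter> ?X" by blast
  have pq: "p \<in> quadric f" "p \<subseteq> H" using p(1) unfolding pw_points_def by auto
  have "col p x \<longleftrightarrow> collinear_pts f x p" if "x \<in> ?X" for x
    using that X pq(1) col_iff[of x p] col_sym[of x p] by blast
  then have "nbrs p \<inter> ?X = {x \<in> ?X. collinear_pts f x p}" by auto
  with p pq show ?thesis by blast
qed

end

theorem theorem5p5:
  fixes f :: "('a::{field,finite}) ^ 6 \<Rightarrow> 'a"
    and H :: "('a ^ 6) set"
    and Y :: "('a ^ 6) set set"
    and q :: nat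
  assumes "CARD('a) = q" and "q > 2"
    and "elliptic_form f"
    and "parabolic_section f H"
    and "pw_intriguing f H Y"
    and "card Y = q^2 * (q - 1)"
    and "\<forall>u\<in>Y. card {v \<in> Y. collinear_pts f u v} = q - 1"
    and "\<forall>u\<in>pw_points f H - Y. card {v \<in> Y. collinear_pts f u v} = q^2 - q"
  shows "\<exists>p\<in>quadric f. p \<subseteq> H \<and>
           Y = {x \<in> pw_points f H. collinear_pts f x p} \<and>
           card {x \<in> pw_points f H. collinear_pts f x p} = (q^2 - q) * q"
proof -
  interpret elliptic_quadric f by unfold_locales (rule assms(3))
  have Y: "Y \<subseteq> pw_points f H" using assms(5) unfolding pw_intriguing_def by blast
  from pencil_of_card_pw[OF assms(4) Y, unfolded assms(1), OF assms(6-8)]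
  obtain p where p: "p \<in> quadric f" "p \<subseteq> H" "Y = {x \<in> pw_points f H. collinear_pts f x p}"
    by (elim bexE conjE)
  have "card Y = (q^2 - q) * q"
    unfolding assms(6) by (simp add: power2_eq_square algebra_simps)
  with p(3) have "card {x \<in> pw_points f H. collinear_pts f x p} = (q^2 - q) * q" by simp
  with p show ?thesis by (intro bexI[of _ p] conjI)
qed

end
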